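(* Let $\theta>0$, $\gamma>0$ and, for $t\in(0,\gamma^{-1})$, let $u(t)$ be the measure on $(0,\infty)$ $$u(t,x)=(1-\gamma t)^{\frac1\gamma}\,\delta\!\left(x-(1-\gamma t)^{-\frac1\gamma}\right)+u^R(t,x)\,H\!\left(1-(1-\gamma t)^{\frac1\gamma}x\right),$$ $$u^R(t,x)=\theta(1-\gamma t)^{\frac2\gamma}\,t\,F\!\left(1+\frac{\sigma_1}\gamma,1+\frac{\sigma_2}\gamma,2,\gamma t\,(1+(\gamma t-1)x^\gamma)\right).$$ Then $$\lim_{\gamma t\to1^-}u(t,x)=\frac{\gamma\,\Gamma(2/\gamma)}{\Gamma(\sigma_1/\gamma)\Gamma(\sigma_2/\gamma)}(1+x^\gamma)^{-\frac2\gamma},\quad\forall x>0,$$ and (limits as $t\to\gamma^{-1}$, $t<\gamma^{-1}$): $$\forall r>1:\quad\lim_{t\to\gamma^{-1}}(1-\gamma t)^{\frac{r-1}\gamma}\int_0^\infty x^ru(t,x)\,dx=\frac{\Gamma\left(\frac{r+1}\gamma\right)\Gamma\left(\frac{r-1}\gamma\right)}{\Gamma\left(\frac{r+1-\sigma_1}\gamma\right)\Gamma\left(\frac{r+1-\sigma_2}\gamma\right)},$$ $$\lim_{t\to\gamma^{-1}}\frac{-1}{\log(1-\gamma t)}\int_0^\infty x\,u(t,x)\,dx=\frac{\Gamma\left(\frac2\gamma\right)}{\Gamma\left(\frac{\sigma_1}\gamma\right)\Gamma\left(\frac{\sigma_2}\gamma\right)},$$ $$\forall r\in(0,1):\quad\lim_{t\to\gamma^{-1}}\int_0^\infty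 x^ru(t,x)\,dx=\frac{\Gamma\left(\frac{r+1}\gamma\right)\Gamma\left(\frac{1-r}\gamma\right)}{\Gamma\left(\frac{\sigma_1}\gamma\right)\Gamma\left(\frac{\sigma_2}\gamma\right)}.$$
   Context: $\sigma_1=1-\sqrt{1-\theta}$, $\sigma_2=1+\sqrt{1-\theta}$ (with $\sqrt{1-\theta}=i\sqrt{\theta-1}$ if $\theta>1$). $F(a,b,c,z)={}_2F_1(a,b;c;z)$ is the Gauss hypergeometric function, $H$ the Heaviside function, $\delta(x-a)$ the Dirac mass at $a$, $\Gamma$ the Gamma function, $1/\Gamma=0$ at the poles of $\Gamma$. Measures are written as if they had densities. In the pointwise limit, for fixed $x$ and $t$ close enough to $\gamma^{-1}$ the measure $u(t)$ has a smooth density near $x$ (the Dirac mass is located at $(1-\gamma t)^{-1/\gamma}\to\infty$), and $u(t,x)$ denotes the value of this density. *)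

theory Defs
  imports "HOL-Probability.Giry_Monad" "HOL-Real_Asymp.Real_Asymp"
begin

(* Only evaluated inside the unit disc, where the Gauss series converges. *)
definition hyp2F1 :: "complex \<Rightarrow> complex \<Rightarrow> complex \<Rightarrow> complex \<Rightarrow> complex" where
  "hyp2F1 a b c z = eval_fps (fps_hypergeo [a, b] [c] 1) z"

(* For \<theta> > 1 the principal root csqrt (1 - \<theta>) is i * sqrt (\<theta> - 1). *)
definition sigma1 :: "real \<Rightarrow> complex" where
  "sigma1 \<theta> = 1 - csqrt (1 - of_real \<theta>)"

definition sigma2 :: "real \<Rightarrow> complex" where
  "sigma2 \<theta> = 1 + csqrt (1 - of_real \<theta>)"

definition heaviside :: "real \<Rightarrow> real" where
  "heaviside y = (if 0 \<le> y then 1 else 0)"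

(* Re discards nothing and the value is nonnegative wherever the Heaviside factor below is
   nonzero: see uR_of_real and uR_nonneg. *)
definition uR :: "real \<Rightarrow> real \<Rightarrow> real \<Rightarrow> real \<Rightarrow> real" where
  "uR \<theta> \<gamma> t x = \<theta> * (1 - \<gamma> * t) powr (2 / \<gamma>) * t *
     Re (hyp2F1 (1 + sigma1 \<theta> / of_real \<gamma>) (1 + sigma2 \<theta> / of_real \<gamma>) 2
           (of_real (\<gamma> * t * (1 + (\<gamma> * t - 1) * x powr \<gamma>))))"

definition sum_of_measures :: "'a measure \<Rightarrow> 'a measure \<Rightarrow> 'a measure" where
  "sum_of_measures M N = measure_of (space M) (sets M) (\<lambda>A. emeasure M A + emeasure N A)"

definition u :: "real \<Rightarrow> real \<Rightarrow> real \<Rightarrow> real measure" where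
  "u \<theta> \<gamma> t = restrict_space
     (sum_of_measures
        (scale_measure (ennreal ((1 - \<gamma> * t) powr (1 / \<gamma>)))
           (return borel ((1 - \<gamma> * t) powr (- (1 / \<gamma>)))))
        (density lborel
           (\<lambda>x. ennreal (uR \<theta> \<gamma> t x * heaviside (1 - (1 - \<gamma> * t) powr (1 / \<gamma>) * x)))))
     {0<..}"

(* On a neighbourhood of x the measure M has a continuous density, with value v at x. *)
definition has_density_value :: "real measure \<Rightarrow> real \<Rightarrow> real \<Rightarrow> bool" where
  "has_density_value M x v \<longleftrightarrow>
     (\<exists>U f. open U \<and> x \<in> U \<and> continuous_on U f \<and> (\<forall>y\<in>U. 0 \<le> f y) \<and>
        (\<forall>A\<in>sets borel. A \<subseteq> U \<longrightarrow>
           A \<in> sets M \<and> emeasure M A = (\<integral>\<^sup>+y\<in>A. ennreal (f y) \<partial>lborel)) \<and> f x = v)"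

(* Meaningful when M has a continuous density near x, which then determines the value
   (has_density_value_unique); for u this is the case as t tends to 1 / \<gamma>
   (eventually_density_at_u). *)
definition density_at :: "real measure \<Rightarrow> real \<Rightarrow> real" where
  "density_at M x = (THE v. has_density_value M x v)"

lemma sets_sum_of_measures [simp]: "sets (sum_of_measures M N) = sets M"
  and space_sum_of_measures [simp]: "space (sum_of_measures M N) = space M"
  unfolding sum_of_measures_def by (simp_all add: sets.space_closed)

lemma emeasure_sum_of_measures:
  assumes "sets N = sets M" "A \<in> sets M"
  shows "emeasure (sum_of_measures M N) A = emeasure M A + emeasure N A"
  unfolding sum_of_measures_def
proof (rule emeasure_measure_of_sigma)
  show "sigma_algebra (space M) (sets M)" by (rule sets.sigma_algebra_axioms)
  show "positive (sets M) (\<lambda>A. emeasure M A + emeasure N A)"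
    by (simp add: positive_def)
  show "countably_additive (sets M) (\<lambda>A. emeasure M A + emeasure N A)"
  proof (rule countably_additiveI)
    fix B :: "nat \<Rightarrow> _" assume B: "range B \<subseteq> sets M" "disjoint_family B"
    show "(\<Sum>i. emeasure M (B i) + emeasure N (B i)) = emeasure M (\<Union>i. B i) + emeasure N (\<Union>i. B i)"
      using B assms(1) by (simp add: suminf_add[symmetric] suminf_emeasure)
  qed
qed (use assms in auto)

lemma sets_u: "sets (u \<theta> \<gamma> t) = sets (restrict_space borel {0<..})"
  unfolding u_def by (rule sets_restrict_space_cong) simp

lemma space_u: "space (u \<theta> \<gamma> t) = {0<..}"
  unfolding u_def by (simp add: space_restrict_space)

lemma uR_measurable [measurable]: "uR \<theta> \<gamma> t \<in> borel_measurable borel"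
  unfolding uR_def hyp2F1_def eval_fps_def by measurable

lemma heaviside_measurable [measurable]: "heaviside \<in> borel_measurable borel"
  unfolding heaviside_def by measurable

lemma emeasure_u:
  assumes "A \<in> sets borel" "A \<subseteq> {0<..}"
  shows "emeasure (u \<theta> \<gamma> t) A =
    ennreal ((1 - \<gamma> * t) powr (1 / \<gamma>)) * indicator A ((1 - \<gamma> * t) powr (- (1 / \<gamma>))) +
    (\<integral>\<^sup>+x\<in>A. ennreal (uR \<theta> \<gamma> t x * heaviside (1 - (1 - \<gamma> * t) powr (1 / \<gamma>) * x)) \<partial>lborel)"
  unfolding u_def using assms
  by (subst emeasure_restrict_space)
     (auto simp: emeasure_sum_of_measures emeasure_density)

lemma sigma_sum: "sigma1 \<theta> + sigma2 \<theta> = 2"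
  by (simp add: sigma1_def sigma2_def)

lemma sigma_prod: "sigma1 \<theta> * sigma2 \<theta> = of_real \<theta>"
proof -
  have "sigma1 \<theta> * sigma2 \<theta> = 1 - (csqrt (1 - of_real \<theta>))\<^sup>2"
    by (simp add: sigma1_def sigma2_def algebra_simps power2_eq_square)
  then show ?thesis by simp
qed

definition hcoeff :: "real \<Rightarrow> real \<Rightarrow> nat \<Rightarrow> real" where
  "hcoeff \<theta> \<gamma> n = (\<Prod>k<n. (1 + real k)\<^sup>2 + 2 * (1 + real k) / \<gamma> + \<theta> / \<gamma>\<^sup>2) / (fact (Suc n) * fact n)"

lemma pochhammer_2: "pochhammer (2 :: complex) n = fact (Suc n)"
  by (induction n) (simp_all add: pochhammer_Suc algebra_simps)

lemma hypergeo_coeff: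
  assumes "\<gamma> > 0"
  shows "fps_nth (fps_hypergeo [1 + sigma1 \<theta> / of_real \<gamma>, 1 + sigma2 \<theta> / of_real \<gamma>] [2] 1) n =
    of_real (hcoeff \<theta> \<gamma> n)"
proof -
  have *: "(1 + sigma1 \<theta> / of_real \<gamma> + of_nat k) * (1 + sigma2 \<theta> / of_real \<gamma> + of_nat k) =
      of_real ((1 + real k)\<^sup>2 + 2 * (1 + real k) / \<gamma> + \<theta> / \<gamma>\<^sup>2)" for k
  proof -
    have "(1 + sigma1 \<theta> / of_real \<gamma> + of_nat k) * (1 + sigma2 \<theta> / of_real \<gamma> + of_nat k) =
      (1 + of_nat k)\<^sup>2 + (1 + of_nat k) * (sigma1 \<theta> + sigma2 \<theta>) / of_real \<gamma>
        + sigma1 \<theta> * sigma2 \<theta> / (of_real \<gamma>)\<^sup>2"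
      using assms by (simp add: field_simps power2_eq_square)
    then show ?thesis by (simp add: sigma_sum sigma_prod algebra_simps)
  qed
  have "pochhammer (1 + sigma1 \<theta> / of_real \<gamma>) n * pochhammer (1 + sigma2 \<theta> / of_real \<gamma>) n =
      of_real (\<Prod>k<n. (1 + real k)\<^sup>2 + 2 * (1 + real k) / \<gamma> + \<theta> / \<gamma>\<^sup>2)"
    unfolding pochhammer_prod prod.distrib[symmetric] of_real_prod * 
    by (simp add: atLeast0LessThan)
  then show ?thesis by (simp add: hcoeff_def pochhammer_2)
qed

lemma hcoeff_pos: "\<theta> > 0 \<Longrightarrow> \<gamma> > 0 \<Longrightarrow> hcoeff \<theta> \<gamma> n > 0"
  unfolding hcoeff_def by (intro divide_pos_pos prod_pos mult_pos_pos) (auto intro!: add_pos_pos)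

lemma hypergeo_conv_radius:
  assumes "\<theta> > 0" "\<gamma> > 0"
  shows "fps_conv_radius (fps_hypergeo [1 + sigma1 \<theta> / of_real \<gamma>, 1 + sigma2 \<theta> / of_real \<gamma>] [2] 1) = 1"
  unfolding fps_conv_radius_def hypergeo_coeff[OF assms(2)]
proof (rule conv_radius_ratio_limit_nonzero[where c = 1])
  have "hcoeff \<theta> \<gamma> n / hcoeff \<theta> \<gamma> (Suc n) =
      ((2 + real n) * (1 + real n)) / ((1 + real n)\<^sup>2 + 2 * (1 + real n) / \<gamma> + \<theta> / \<gamma>\<^sup>2)" for n
  proof -
    define q where "q = (1 + real n)\<^sup>2 + 2 * (1 + real n) / \<gamma> + \<theta> / \<gamma>\<^sup>2"
    have q: "q > 0" unfolding q_def using assms by (auto intro!: add_pos_pos)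
    have "hcoeff \<theta> \<gamma> (Suc n) = hcoeff \<theta> \<gamma> n * q / ((2 + real n) * (1 + real n))"
    proof -
      have fact: "fact (Suc (Suc n)) * fact (Suc n) = (fact (Suc n) * fact n) * ((2 + real n) * (1 + real n))"
        by (simp add: algebra_simps)
      show ?thesis
        unfolding hcoeff_def prod.lessThan_Suc q_def[symmetric] fact by (simp only: times_divide_eq_left divide_divide_eq_left)
    qed
    then show ?thesis using q hcoeff_pos[OF assms, of n] unfolding q_def[symmetric]
      by (simp add: field_simps)
  qed
  moreover have "(\<lambda>n. ((2 + real n) * (1 + real n)) /
      ((1 + real n)\<^sup>2 + 2 * (1 + real n) / \<gamma> + \<theta> / \<gamma>\<^sup>2)) \<longlonglongrightarrow> 1"
    using assms by real_asymp
  ultimately show "(\<lambda>n. norm (complex_of_real (hcoeff \<theta> \<gamma> n)) /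
      norm (complex_of_real (hcoeff \<theta> \<gamma> (Suc n)))) \<longlonglongrightarrow> 1"
    using hcoeff_pos[OF assms] by (simp add: abs_of_pos)
qed (simp_all add: one_ereal_def)

lemma hyp2F1_real_nonneg:
  assumes "\<theta> > 0" "\<gamma> > 0" "0 \<le> z" "z < 1"
  defines "h \<equiv> hyp2F1 (1 + sigma1 \<theta> / of_real \<gamma>) (1 + sigma2 \<theta> / of_real \<gamma>) 2 (of_real z)"
  shows "h = of_real (Re h)" "0 \<le> Re h"
proof -
  let ?F = "fps_hypergeo [1 + sigma1 \<theta> / of_real \<gamma>, 1 + sigma2 \<theta> / of_real \<gamma>] [2] 1"
  have "summable (\<lambda>n. fps_nth ?F n * of_real z ^ n)"
    by (rule summable_fps) (use assms hypergeo_conv_radius[of \<theta> \<gamma>] in simp)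
  then have s: "summable (\<lambda>n. complex_of_real (hcoeff \<theta> \<gamma> n * z ^ n))"
    unfolding hypergeo_coeff[OF assms(2)] by simp
  then have s': "summable (\<lambda>n. hcoeff \<theta> \<gamma> n * z ^ n)"
    by (simp only: summable_complex_of_real)
  have eq: "h = of_real (\<Sum>n. hcoeff \<theta> \<gamma> n * z ^ n)"
    unfolding h_def hyp2F1_def eval_fps_def hypergeo_coeff[OF assms(2)]
    using suminf_of_real[OF s', where 'a = complex] by simp
  then show "h = of_real (Re h)" by simp
  show "0 \<le> Re h" unfolding eq Re_complex_of_real
    using assms hcoeff_pos[of \<theta> \<gamma>] by (intro suminf_nonneg[OF s']) (simp add: less_imp_le)
qed

lemma heaviside_arg:
  fixes \<gamma> t x :: real
  assumes "\<gamma> > 0" "0 < t" "t < 1 / \<gamma>" "0 < x" "(1 - \<gamma> * t) powr (1 / \<gamma>) * x \<le> 1"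
  shows "0 \<le> \<gamma> * t * (1 + (\<gamma> * t - 1) * x powr \<gamma>)" "\<gamma> * t * (1 + (\<gamma> * t - 1) * x powr \<gamma>) < 1"
proof -
  have gt0: "0 < \<gamma> * t" using \<open>\<gamma> > 0\<close> \<open>0 < t\<close> by (rule mult_pos_pos)
  have gt1: "\<gamma> * t < 1" using \<open>t < 1 / \<gamma>\<close> \<open>\<gamma> > 0\<close> by (simp add: field_simps)
  note gt = gt0 gt1
  have "((1 - \<gamma> * t) powr (1 / \<gamma>) * x) powr \<gamma> \<le> 1"
    using powr_mono2[of \<gamma> "(1 - \<gamma> * t) powr (1 / \<gamma>) * x" 1] assms by simp
  then have le: "(1 - \<gamma> * t) * x powr \<gamma> \<le> 1"
    using assms gt by (simp add: powr_mult powr_powr)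
  have ge: "0 \<le> (1 - \<gamma> * t) * x powr \<gamma>" using gt by simp
  have eq: "1 + (\<gamma> * t - 1) * x powr \<gamma> = 1 - (1 - \<gamma> * t) * x powr \<gamma>" by (simp add: algebra_simps)
  show "0 \<le> \<gamma> * t * (1 + (\<gamma> * t - 1) * x powr \<gamma>)" unfolding eq using le gt by simp
  have "\<gamma> * t * (1 - (1 - \<gamma> * t) * x powr \<gamma>) \<le> \<gamma> * t * 1"
    using ge gt by (intro mult_left_mono) auto
  then show "\<gamma> * t * (1 + (\<gamma> * t - 1) * x powr \<gamma>) < 1" unfolding eq using gt by linarith
qed

lemma uR_of_real:
  assumes "\<theta> > 0" "\<gamma> > 0" "0 < t" "t < 1 / \<gamma>" "0 < x" "(1 - \<gamma> * t) powr (1 / \<gamma>) * x \<le> 1"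
  shows "of_real (uR \<theta> \<gamma> t x) = of_real (\<theta> * (1 - \<gamma> * t) powr (2 / \<gamma>) * t) *
     hyp2F1 (1 + sigma1 \<theta> / of_real \<gamma>) (1 + sigma2 \<theta> / of_real \<gamma>) 2
       (of_real (\<gamma> * t * (1 + (\<gamma> * t - 1) * x powr \<gamma>)))"
  using hyp2F1_real_nonneg(1)[OF assms(1,2) heaviside_arg[OF assms(2-6)]]
  unfolding uR_def of_real_mult by simp

lemma uR_nonneg:
  assumes "\<theta> > 0" "\<gamma> > 0" "0 < t" "t < 1 / \<gamma>" "0 < x" "(1 - \<gamma> * t) powr (1 / \<gamma>) * x \<le> 1"
  shows "0 \<le> uR \<theta> \<gamma> t x"
  using hyp2F1_real_nonneg(2)[OF assms(1,2) heaviside_arg[OF assms(2-6)]] assms(1,3)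
  unfolding uR_def by simp

lemma has_density_value_unique:
  assumes "has_density_value M x v" "has_density_value M x w"
  shows "v = w"
proof -
  have "\<not> v < w" if v: "has_density_value M x v" and w: "has_density_value M x w" for v w
  proof
    assume "v < w"
    from v obtain U f where U: "open U" "x \<in> U" "continuous_on U f" "\<And>y. y \<in> U \<Longrightarrow> 0 \<le> f y"
      "\<And>A. A \<in> sets borel \<Longrightarrow> A \<subseteq> U \<Longrightarrow> emeasure M A = (\<integral>\<^sup>+y\<in>A. ennreal (f y) \<partial>lborel)" "f x = v"
      unfolding has_density_value_def by blast
    from w obtain V g where V: "open V" "x \<in> V" "continuous_on V g" "\<And>y. y \<in> V \<Longrightarrow> 0 \<le> g y"
      "\<And>A. A \<in> sets borel \<Longrightarrow> A \<subseteq> V \<Longrightarrow> emeasure M A = (\<integral>\<^sup>+y\<in>A. ennreal (g y) \<partial>lborel)" "g x = w"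
      unfolding has_density_value_def by blast
    define m where "m = (v + w) / 2"
    have "0 \<le> v" using U(2,4,6) by blast
    then have m: "v < m" "m < w" "0 \<le> v" "0 < m" using \<open>v < w\<close> by (simp_all add: m_def)
    have "open (U \<inter> f -` {..<m})" "open (V \<inter> g -` {m<..})"
      using U V by (auto intro!: continuous_open_preimage)
    then have "open ((U \<inter> f -` {..<m}) \<inter> (V \<inter> g -` {m<..}))" by (rule open_Int)
    moreover have "x \<in> (U \<inter> f -` {..<m}) \<inter> (V \<inter> g -` {m<..})" using U V m by auto
    ultimately obtain e where e: "e > 0" "cball x e \<subseteq> (U \<inter> f -` {..<m}) \<inter> (V \<inter> g -` {m<..})"
      using open_contains_cball by blast
    define K where "K = cball x e"
    have K: "compact K" "x \<in> K" "K \<noteq> {}" "K \<subseteq> U" "K \<subseteq> V" "K \<in> sets borel"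
      "\<And>y. y \<in> K \<Longrightarrow> f y < m" "\<And>y. y \<in> K \<Longrightarrow> m < g y"
      using e by (auto simp: K_def)
    have "continuous_on K f" using U(3) K(4) by (rule continuous_on_subset)
    then obtain y0 where y0: "y0 \<in> K" "\<And>y. y \<in> K \<Longrightarrow> f y \<le> f y0"
      using continuous_attains_sup[OF K(1,3)] by blast
    have lK: "emeasure lborel K = ennreal (2 * e)"
      unfolding K_def cball_eq_atLeastAtMost using e by simp
    have "ennreal m * emeasure lborel K = (\<integral>\<^sup>+y\<in>K. ennreal m \<partial>lborel)"
      using K by (simp add: nn_integral_cmult_indicator)
    also have "\<dots> \<le> (\<integral>\<^sup>+y\<in>K. ennreal (g y) \<partial>lborel)"
      using K(8) by (intro nn_integral_mono) (simp add: indicator_def less_imp_le ennreal_leI)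
    also have "\<dots> = emeasure M K" using V K by simp
    also have "\<dots> = (\<integral>\<^sup>+y\<in>K. ennreal (f y) \<partial>lborel)" using U K by simp
    also have "\<dots> \<le> (\<integral>\<^sup>+y\<in>K. ennreal (f y0) \<partial>lborel)"
      using y0(2) by (intro nn_integral_mono) (simp add: indicator_def ennreal_leI)
    also have "\<dots> = ennreal (f y0) * emeasure lborel K"
      using K by (simp add: nn_integral_cmult_indicator)
    finally have "ennreal (m * (2 * e)) \<le> ennreal (f y0 * (2 * e))"
      unfolding lK using m e U(4) y0(1) K(4) by (simp add: ennreal_mult[symmetric] subset_iff)
    then have "m * (2 * e) \<le> f y0 * (2 * e)"
      using U(4)[of y0] y0(1) K(4) e by (subst (asm) ennreal_le_iff) auto
    then show False using e K(7)[OF y0(1)] by simp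
  qed
  from this[OF assms] this[OF assms(2,1)] show ?thesis by simp
qed

lemma density_at_eqI: "has_density_value M x v \<Longrightarrow> density_at M x = v"
  unfolding density_at_def by (blast intro: has_density_value_unique)

lemma has_density_value_u:
  assumes "\<theta> > 0" "\<gamma> > 0" "0 < t" "t < 1 / \<gamma>" "0 < x" "x < (1 - \<gamma> * t) powr (- (1 / \<gamma>))"
  shows "has_density_value (u \<theta> \<gamma> t) x (uR \<theta> \<gamma> t x)"
proof -
  define X where "X = (1 - \<gamma> * t) powr (- (1 / \<gamma>))"
  have gt0: "0 < \<gamma> * t" using \<open>\<gamma> > 0\<close> \<open>0 < t\<close> by (rule mult_pos_pos)
  have gt1: "\<gamma> * t < 1" using \<open>t < 1 / \<gamma>\<close> \<open>\<gamma> > 0\<close> by (simp add: field_simps)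
  note gt = gt0 gt1
  have inX: "(1 - \<gamma> * t) powr (1 / \<gamma>) * y \<le> 1" if "y < X" for y
  proof -
    have "(1 - \<gamma> * t) powr (1 / \<gamma>) * y \<le> (1 - \<gamma> * t) powr (1 / \<gamma>) * X"
      using that by (intro mult_left_mono) auto
    also have "\<dots> = 1" using gt by (simp add: X_def powr_add[symmetric])
    finally show ?thesis .
  qed
  let ?F = "fps_hypergeo [1 + sigma1 \<theta> / of_real \<gamma>, 1 + sigma2 \<theta> / of_real \<gamma>] [2] (1::complex)"
  have c: "continuous_on {0<..<X} (uR \<theta> \<gamma> t)"
    unfolding uR_def hyp2F1_def
  proof (intro continuous_intros subsetI; (elim imageE)?)
    fix z y assume z: "z = complex_of_real (\<gamma> * t * (1 + (\<gamma> * t - 1) * y powr \<gamma>))"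
      and y: "y \<in> {0<..<X}"
    have "\<bar>\<gamma> * t * (1 + (\<gamma> * t - 1) * y powr \<gamma>)\<bar> < 1"
      using heaviside_arg[OF assms(2-4), of y] y inX[of y] by simp
    then show "z \<in> eball 0 (fps_conv_radius ?F)"
      unfolding z hypergeo_conv_radius[OF assms(1,2)] in_eball_iff
      by (simp only: dist_0_norm norm_of_real one_ereal_def less_ereal.simps)
  qed auto
  show ?thesis
    unfolding has_density_value_def
  proof (intro exI conjI ballI impI)
    show "open {0<..<X}" by simp
    show "x \<in> {0<..<X}" using assms by (simp add: X_def)
    show "continuous_on {0<..<X} (uR \<theta> \<gamma> t)" by (rule c)
    show "0 \<le> uR \<theta> \<gamma> t y" if "y \<in> {0<..<X}" for y
      using that inX[of y] by (intro uR_nonneg assms) auto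
    fix A :: "real set" assume A: "A \<in> sets borel" "A \<subseteq> {0<..<X}"
    then have A0: "A \<subseteq> {0<..}" "X \<notin> A" by auto
    show "A \<in> sets (u \<theta> \<gamma> t)" using A A0 by (simp add: sets_u sets_restrict_space_iff)
    have "emeasure (u \<theta> \<gamma> t) A =
        (\<integral>\<^sup>+x\<in>A. ennreal (uR \<theta> \<gamma> t x * heaviside (1 - (1 - \<gamma> * t) powr (1 / \<gamma>) * x)) \<partial>lborel)"
      unfolding emeasure_u[OF A(1) A0(1)] X_def[symmetric] using A0(2) by simp
    also have "\<dots> = (\<integral>\<^sup>+y\<in>A. ennreal (uR \<theta> \<gamma> t y) \<partial>lborel)"
      using A(2) inX by (intro nn_integral_cong) (auto simp: indicator_def heaviside_def)
    finally show "emeasure (u \<theta> \<gamma> t) A = (\<integral>\<^sup>+y\<in>A. ennreal (uR \<theta> \<gamma> t y) \<partial>lborel)" .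
  qed simp
qed

lemma eventually_density_at_u:
  assumes "\<theta> > 0" "\<gamma> > 0" "0 < x"
  shows "\<forall>\<^sub>F t in at_left (1 / \<gamma>). has_density_value (u \<theta> \<gamma> t) x (uR \<theta> \<gamma> t x) \<and>
    density_at (u \<theta> \<gamma> t) x = uR \<theta> \<gamma> t x"
proof -
  have "filterlim (\<lambda>t. (1 - \<gamma> * t) powr (- (1 / \<gamma>))) at_top (at_left (1 / \<gamma>))"
  proof -
    have "filterlim (\<lambda>s. s powr (- (1 / \<gamma>))) at_top (at_right 0)" using assms by real_asymp
    moreover have "filterlim (\<lambda>t. 1 - \<gamma> * t) (at_right 0) (at_left (1 / \<gamma>))"
      unfolding filterlim_at
    proof
      show "\<forall>\<^sub>F t in at_left (1 / \<gamma>). 1 - \<gamma> * t \<in> {0<..} \<and> 1 - \<gamma> * t \<noteq> 0"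
        unfolding eventually_at_left_field using assms
        by (intro exI[of _ 0]) (auto simp: field_simps)
      show "((\<lambda>t. 1 - \<gamma> * t) \<longlongrightarrow> 0) (at_left (1 / \<gamma>))"
        using assms by (auto intro!: tendsto_eq_intros)
    qed
    ultimately show ?thesis by (rule filterlim_compose)
  qed
  then have "\<forall>\<^sub>F t in at_left (1 / \<gamma>). x < (1 - \<gamma> * t) powr (- (1 / \<gamma>))"
    by (simp add: filterlim_at_top_dense)
  moreover have "\<forall>\<^sub>F t in at_left (1 / \<gamma>). 0 < t \<and> t < 1 / \<gamma>"
    unfolding eventually_at_left_field using assms by (intro exI[of _ 0]) auto
  ultimately show ?thesis
    by eventually_elim (use assms has_density_value_u density_at_eqI in blast)
qed

end

theory Submission
  imports Defs
begin

text \<open>Write $q = 1 - \gamma t$, $a = \sigma_1/\gamma$, $b = \sigma_2/\gamma$ and $p = (r+1)/\gamma$. Integrating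
  the hypergeometric series of $u^R$ term by term (with $y = q x^\gamma$ each term is a Beta integral) and
  adding the atom gives $\int x^r u(t,x)\,dx = q^{(1-r)/\gamma} F(a,b,p,\gamma t)$, where
  $p - a - b = (r-1)/\gamma$. All four limits are then the boundary behaviour of a Gauss series at $1$.
  If $p > a+b$ this is Gauss's summation theorem. Otherwise Gauss's product formula for $1/\Gamma$ gives the
  asymptotics of the coefficients, which are compared with those of $(1-z)^{-d}$ or $-\ln(1-z)$.\<close>

subsection \<open>Gauss's summation theorem\<close>

text \<open>For \<theta> > 1 the parameters a and b are complex conjugates, so the Gauss series are
  studied over the complex numbers, whereas exchanging sum and integral under the measure relies on
  nonnegative real terms. The two sides meet in the identity (a + k)(b + k) = k^2 + 2k/\<gamma> +
  \<theta>/\<gamma>^2: it involves only a + b = 2/\<gamma> and a b = \<theta>/\<gamma>^2, and it is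
  real and positive for every k. The real coefficients \<open>hcoeff\<close> and
  \<open>rcoeff\<close> are built from such products.

  The atom is what completes the moment series. Since (a)_{n+1} (b)_{n+1} = a b (1+a)_n (1+b)_n,
  term n of the density produces term n + 1 of F(a,b,p,.), and the atom is exactly the missing
  constant term.

  For the pointwise limit the argument z of F satisfies 1 - z = q (1 + \<gamma> t x^\<gamma>), while
  F(1+a,1+b,2,z) grows like (1 - z)^(-2/\<gamma>). The prefactor q^(2/\<gamma>) of the density
  cancels this growth and leaves the profile in x.\<close>

lemma Re_pos_not_nonpos_Int:
  fixes z :: complex
  shows "Re z > 0 \<Longrightarrow> z \<notin> \<int>\<^sub>\<le>\<^sub>0"
  by (auto elim!: nonpos_Ints_cases)

text \<open>\<open>rGamma_series z n\<close> is (z)_{n+1} / (n! n^z). In a quotient of two pairs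
  with equal parameter sums, the factorials and the powers of n cancel exactly and only the
  Pochhammer quotient remains, with its index shifted by one.\<close>

lemma pochhammer_ratio_LIMSEQ:
  fixes a b c d :: complex
  assumes "a + b = c + d" "c \<notin> \<int>\<^sub>\<le>\<^sub>0" "d \<notin> \<int>\<^sub>\<le>\<^sub>0"
  shows "(\<lambda>n. pochhammer a n * pochhammer b n / (pochhammer c n * pochhammer d n))
           \<longlonglongrightarrow> rGamma a * rGamma b / (rGamma c * rGamma d)"
proof -
  have lim: "(\<lambda>n. rGamma_series a n * rGamma_series b n / (rGamma_series c n * rGamma_series d n))
      \<longlonglongrightarrow> rGamma a * rGamma b / (rGamma c * rGamma d)"
    using assms by (intro tendsto_intros) (auto simp: rGamma_eq_zero_iff)
  have eq: "rGamma_series a n * rGamma_series b n / (rGamma_series c n * rGamma_series d n) =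
      pochhammer a (Suc n) * pochhammer b (Suc n) / (pochhammer c (Suc n) * pochhammer d (Suc n))" for n
  proof -
    define E where "E z = exp (z * complex_of_real (ln (of_nat n)))" for z
    have "E a * E b = E c * E d"
      unfolding E_def exp_add[symmetric] using assms(1) by (metis distrib_right)
    moreover have "E z \<noteq> 0" for z by (simp add: E_def)
    moreover have "x / (f * u) * (y / (f * v)) / (z / (f * u') * (w / (f * v'))) = x * y / (z * w)"
      if "u * v = u' * v'" "u \<noteq> 0" "v \<noteq> 0" "u' \<noteq> 0" "v' \<noteq> 0" "f \<noteq> 0"
      for x y z w u v u' v' f :: complex
    proof -
      have "x / (f * u) * (y / (f * v)) / (z / (f * u') * (w / (f * v'))) =
          (x * y) / (f * f * (u * v)) / ((z * w) / (f * f * (u' * v')))"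
        by (simp add: mult_ac)
      also have "\<dots> = x * y / (z * w)"
        using that by (simp add: field_simps)
      finally show ?thesis .
    qed
    ultimately show ?thesis
      unfolding rGamma_series_def E_def[symmetric] by simp
  qed
  show ?thesis
    using lim unfolding eq by (simp only: filterlim_sequentially_Suc[of "\<lambda>n. pochhammer a n * pochhammer b n / (pochhammer c n * pochhammer d n)"])
qed

section \<open>Growth of the coefficients of a Gauss series\<close>

definition gauss_coeff :: "complex \<Rightarrow> complex \<Rightarrow> complex \<Rightarrow> nat \<Rightarrow> complex" where
  "gauss_coeff a b c n = pochhammer a n * pochhammer b n / (pochhammer c n * fact n)"

lemma gauss_coeff_Suc:
  "gauss_coeff a b c (Suc n) = (a + of_nat n) * (b + of_nat n) / ((c + of_nat n) * of_nat (Suc n)) * gauss_coeff a b c n"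
  by (simp add: gauss_coeff_def pochhammer_Suc mult_ac del: of_nat_Suc)

text \<open>As n! = (1)_n, the coefficient is again a quotient of values of
  \<open>rGamma_series\<close>, now with parameter sums a + b and c + 1. The powers of n do not
  cancel; they leave the compensating factor n^(c+1-a-b).\<close>

lemma gauss_coeff_LIMSEQ:
  assumes "c \<notin> \<int>\<^sub>\<le>\<^sub>0"
  shows "(\<lambda>n. gauss_coeff a b c (Suc n) * exp ((c + 1 - a - b) * of_real (ln (of_nat n))))
           \<longlonglongrightarrow> rGamma a * rGamma b / rGamma c"
proof -
  have "(\<lambda>n. rGamma_series a n * rGamma_series b n / (rGamma_series c n * rGamma_series 1 n))
      \<longlonglongrightarrow> rGamma a * rGamma b / (rGamma c * rGamma 1)"
    using assms by (intro tendsto_intros) (auto simp: rGamma_eq_zero_iff)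
  moreover have "rGamma_series a n * rGamma_series b n / (rGamma_series c n * rGamma_series 1 n) =
      gauss_coeff a b c (Suc n) * exp ((c + 1 - a - b) * of_real (ln (of_nat n)))" for n
  proof -
    define l where "l = complex_of_real (ln (of_nat n))"
    have "exp ((c + 1 - a - b) * l) = exp (c * l) * exp (1 * l) / (exp (a * l) * exp (b * l))"
      unfolding exp_add[symmetric] exp_diff[symmetric] by (simp add: algebra_simps)
    then show ?thesis
      unfolding rGamma_series_def gauss_coeff_def l_def[symmetric] pochhammer_fact Suc_eq_plus1[symmetric]
      by (simp add: mult_ac flip: pochhammer_fact)
  qed
  ultimately show ?thesis by simp
qed

text \<open>A convergent sequence is bounded, and only the real part of the exponent is visible in
  the norm. Coefficient n + 1 is measured by a power of n, as in \<open>rGamma_series\<close>; n = 0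
  is excluded because 0 \<open>powr\<close> anything is 0.\<close>

lemma gauss_coeff_bound:
  assumes "c \<notin> \<int>\<^sub>\<le>\<^sub>0"
  obtains K where "\<And>n. n \<ge> 1 \<Longrightarrow> norm (gauss_coeff a b c (Suc n)) \<le> K * real n powr (- 1 - Re (c - a - b))"
proof -
  have "Bseq (\<lambda>n. gauss_coeff a b c (Suc n) * exp ((c + 1 - a - b) * of_real (ln (of_nat n))))"
    using gauss_coeff_LIMSEQ[OF assms] by (intro convergent_imp_Bseq) (auto simp: convergent_def)
  then obtain K where K: "\<And>n. norm (gauss_coeff a b c (Suc n) * exp ((c + 1 - a - b) * of_real (ln (of_nat n)))) \<le> K"
    by (elim BseqE) blast
  have "norm (gauss_coeff a b c (Suc n)) \<le> K * real n powr (- 1 - Re (c - a - b))" if "n \<ge> 1" for n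
  proof -
    have "norm (exp ((c + 1 - a - b) * complex_of_real (ln (of_nat n)))) = real n powr (1 + Re (c - a - b))"
      using that by (simp add: powr_def algebra_simps)
    then have "norm (gauss_coeff a b c (Suc n)) * real n powr (1 + Re (c - a - b)) \<le> K"
      using K[of n] by (simp add: norm_mult)
    then have "norm (gauss_coeff a b c (Suc n)) * real n powr (1 + Re (c - a - b)) * real n powr (- 1 - Re (c - a - b))
        \<le> K * real n powr (- 1 - Re (c - a - b))"
      by (rule mult_right_mono) simp
    then show ?thesis using that by (simp add: mult.assoc flip: powr_add)
  qed
  then show ?thesis by (rule that)
qed

lemma gauss_coeff_summable:
  assumes "c \<notin> \<int>\<^sub>\<le>\<^sub>0" "Re (c - a - b) > 0"
  shows "summable (\<lambda>n. norm (gauss_coeff a b c n))"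
proof -
  obtain K where K: "\<And>n. n \<ge> 1 \<Longrightarrow> norm (gauss_coeff a b c (Suc n)) \<le> K * real n powr (- 1 - Re (c - a - b))"
    using gauss_coeff_bound[OF assms(1)] by blast
  have "summable (\<lambda>n. K * real n powr (- 1 - Re (c - a - b)))"
    using assms(2) by (intro summable_mult) (simp add: summable_real_powr_iff)
  then have "summable (\<lambda>n. norm (gauss_coeff a b c (Suc n)))"
    by (rule summable_comparison_test'[where N = 1]) (use K in auto)
  then show ?thesis by (simp only: summable_Suc_iff[of "\<lambda>n. norm (gauss_coeff a b c n)"])
qed

text \<open>Provides the vanishing boundary term of the telescoping sum in
  \<open>gauss_sum_contiguous\<close>: n times the coefficient is O(n^(-e)) with e = Re (c - a -
  b).\<close>

lemma gauss_coeff_times_n_LIMSEQ: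
  assumes "c \<notin> \<int>\<^sub>\<le>\<^sub>0" "Re (c - a - b) > 0"
  shows "(\<lambda>n. of_nat n * gauss_coeff a b c n) \<longlonglongrightarrow> 0"
proof -
  obtain K where K: "\<And>n. n \<ge> 1 \<Longrightarrow> norm (gauss_coeff a b c (Suc n)) \<le> K * real n powr (- 1 - Re (c - a - b))"
    using gauss_coeff_bound[OF assms(1)] by blast
  define e where "e = Re (c - a - b)"
  have "e > 0" using assms by (simp add: e_def)
  then have "(\<lambda>n. (real n + 1) * (K * real n powr (- 1 - e))) \<longlonglongrightarrow> 0"
    by real_asymp
  then have "(\<lambda>n. of_nat (Suc n) * gauss_coeff a b c (Suc n)) \<longlonglongrightarrow> 0"
  proof (rule Lim_null_comparison[rotated])
    show "\<forall>\<^sub>F n in sequentially. norm (of_nat (Suc n) * gauss_coeff a b c (Suc n)) \<le> (real n + 1) * (K * real n powr (- 1 - e))"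
      using eventually_ge_at_top[of 1]
    proof eventually_elim
      case (elim n)
      show ?case unfolding norm_mult norm_of_nat e_def
        by (rule mult_mono) (use K[OF elim] in auto)
    qed
  qed
  then show ?thesis by (simp only: filterlim_sequentially_Suc[of "\<lambda>n. of_nat n * gauss_coeff a b c n"])
qed

section \<open>Gauss's theorem by shifting c to c + n\<close>

lemma not_nonpos_Int_add_of_nat_neq_0:
  fixes c :: complex
  assumes "c \<notin> \<int>\<^sub>\<le>\<^sub>0"
  shows "c + of_nat n \<noteq> 0"
  using assms by (metis plus_of_nat_eq_0_imp)

lemma not_nonpos_Int_add_1:
  fixes c :: complex
  assumes "c \<notin> \<int>\<^sub>\<le>\<^sub>0"
  shows "c + 1 \<notin> \<int>\<^sub>\<le>\<^sub>0"
  using plus_one_in_nonpos_Ints_imp assms by blast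

text \<open>The difference of the two sides telescopes: with $A_n$ the coefficients for $c$, its $n$-th term
  is $c\,(n A_n - (n+1) A_{n+1})$.\<close>

lemma gauss_sum_contiguous:
  assumes c: "c \<notin> \<int>\<^sub>\<le>\<^sub>0" and "Re (c - a - b) > 0"
  shows "c * (c - a - b) * (\<Sum>n. gauss_coeff a b c n) = (c - a) * (c - b) * (\<Sum>n. gauss_coeff a b (c + 1) n)"
proof -
  let ?A = "gauss_coeff a b c"
  have c1: "c + 1 \<notin> \<int>\<^sub>\<le>\<^sub>0" by (rule not_nonpos_Int_add_1[OF c])
  have s: "summable ?A" "summable (gauss_coeff a b (c + 1))"
    using gauss_coeff_summable[OF assms] gauss_coeff_summable[OF c1, of a b] assms(2)
    by (auto intro: summable_norm_cancel)
  have "(\<lambda>n. c * (of_nat n * ?A n - of_nat (Suc n) * ?A (Suc n))) sums (c * (of_nat 0 * ?A 0 - 0))"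
    by (intro sums_mult telescope_sums' gauss_coeff_times_n_LIMSEQ assms)
  moreover have "c * (of_nat n * ?A n - of_nat (Suc n) * ?A (Suc n)) =
      c * (c - a - b) * ?A n - (c - a) * (c - b) * gauss_coeff a b (c + 1) n" for n
  proof -
    have nz: "c + of_nat n \<noteq> 0" "c \<noteq> 0" using not_nonpos_Int_add_of_nat_neq_0[OF c] not_nonpos_Int_add_of_nat_neq_0[OF c, of 0] by auto
    have "pochhammer c n * (c + of_nat n) = c * pochhammer (c + 1) n"
      by (metis pochhammer_Suc pochhammer_rec)
    moreover have "pochhammer c n \<noteq> 0" "pochhammer (c + 1) n \<noteq> 0"
      using c c1 by (auto simp: pochhammer_eq_0_iff)
    ultimately have A1: "gauss_coeff a b (c + 1) n = ?A n * (c / (c + of_nat n))"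
      using nz by (simp add: gauss_coeff_def divide_simps)
    have "of_nat (Suc n) * ?A (Suc n) = ?A n * ((a + of_nat n) * (b + of_nat n) / (c + of_nat n))"
    proof -
      have "k * (x / (y * k) * z) = z * (x / y)" if "k \<noteq> 0" for k x y z :: complex
        using that by (cases "y = 0") (simp_all add: field_simps)
      then show ?thesis unfolding gauss_coeff_Suc by (metis of_nat_neq_0)
    qed
    then have "c * (of_nat n * ?A n - of_nat (Suc n) * ?A (Suc n)) =
        ?A n * (c * (of_nat n - ((a + of_nat n) * (b + of_nat n) / (c + of_nat n))))"
      by (simp add: algebra_simps)
    \<comment> \<open>Partial fractions in n, from n (c + n) - (a + n)(b + n) = (c - a - b)(c + n) -
      (c - a)(c - b). The quotient c / (c + n) that remains is the one relating the coefficients for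
      c + 1 to those for c.\<close>
    also have "c * (of_nat n - ((a + of_nat n) * (b + of_nat n) / (c + of_nat n))) =
        c * (c - a - b) - (c - a) * (c - b) * (c / (c + of_nat n))"
      using nz by (simp add: divide_simps) (simp add: algebra_simps)
    also have "?A n * \<dots> = c * (c - a - b) * ?A n - (c - a) * (c - b) * gauss_coeff a b (c + 1) n"
    proof -
      have "x * (y - z * w) = y * x - z * (x * w)" for x y z w :: complex by (simp add: algebra_simps)
      then show ?thesis unfolding A1 .
    qed
    finally show ?thesis .
  qed
  moreover have "(\<lambda>n. c * (c - a - b) * ?A n - (c - a) * (c - b) * gauss_coeff a b (c + 1) n) sums
      (c * (c - a - b) * suminf ?A - (c - a) * (c - b) * suminf (gauss_coeff a b (c + 1)))"
    using s by (intro sums_diff sums_mult summable_sums)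
  ultimately show ?thesis by (simp add: sums_iff)
qed

text \<open>Iterates \<open>gauss_sum_contiguous\<close>. The induction is over all c:
  \<open>pochhammer_rec\<close> peels off the first factor and leaves Pochhammer symbols whose base
  has moved along with c to c + 1.\<close>

lemma gauss_sum_shift:
  assumes "c \<notin> \<int>\<^sub>\<le>\<^sub>0" "Re (c - a - b) > 0"
  shows "pochhammer c n * pochhammer (c - a - b) n * (\<Sum>k. gauss_coeff a b c k) =
    pochhammer (c - a) n * pochhammer (c - b) n * (\<Sum>k. gauss_coeff a b (c + of_nat n) k)"
  using assms
proof (induction n arbitrary: c)
  case (Suc n)
  have 1: "c + 1 \<notin> \<int>\<^sub>\<le>\<^sub>0" by (rule not_nonpos_Int_add_1[OF Suc.prems(1)])
  have 2: "Re (c + 1 - a - b) > 0" using Suc.prems(2) by simp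
  have eqs: "c - a - b + 1 = c + 1 - a - b" "c - a + 1 = c + 1 - a" "c - b + 1 = c + 1 - b"
    "c + of_nat (Suc n) = c + 1 + of_nat n" by simp_all
  have "pochhammer c (Suc n) * pochhammer (c - a - b) (Suc n) * (\<Sum>k. gauss_coeff a b c k) =
      pochhammer (c + 1) n * pochhammer (c + 1 - a - b) n * (c * (c - a - b) * (\<Sum>k. gauss_coeff a b c k))"
    unfolding pochhammer_rec eqs by (simp only: mult_ac)
  also have "\<dots> = (c - a) * (c - b) * (pochhammer (c + 1) n * pochhammer (c + 1 - a - b) n *
      (\<Sum>k. gauss_coeff a b (c + 1) k))"
    unfolding gauss_sum_contiguous[OF Suc.prems] by (simp only: mult_ac)
  also have "\<dots> = pochhammer (c - a) (Suc n) * pochhammer (c - b) (Suc n) *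
      (\<Sum>k. gauss_coeff a b (c + of_nat (Suc n)) k)"
    unfolding Suc.IH[OF 1 2] pochhammer_rec eqs by (simp only: mult_ac)
  finally show ?case .
qed simp

text \<open>Dominated convergence for series. As c + n tends to infinity every coefficient with k >
  0 vanishes and the constant one stays 1, which is the limit 0 ^ k; the coefficients for c itself
  are the majorant.\<close>

lemma gauss_sum_shift_LIMSEQ:
  assumes "Re c > 0" "Re (c - a - b) > 0"
  shows "(\<lambda>n. \<Sum>k. gauss_coeff a b (c + of_nat n) k) \<longlonglongrightarrow> 1"
proof -
  have c: "c \<notin> \<int>\<^sub>\<le>\<^sub>0" using assms(1) by (intro Re_pos_not_nonpos_Int) simp
  have lim: "(\<lambda>n. gauss_coeff a b (c + of_nat n) k) \<longlonglongrightarrow> 0 ^ k" for k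
  proof -
    have "filterlim (\<lambda>n. c + of_nat n) at_infinity sequentially"
      by (intro tendsto_add_filterlim_at_infinity[OF tendsto_const] tendsto_of_nat)
    then have "(\<lambda>n. inverse (c + of_nat n + of_nat i)) \<longlonglongrightarrow> 0" for i
      by (intro filterlim_compose[OF tendsto_inverse_0] tendsto_add_filterlim_at_infinity'[OF _ tendsto_const])
    then have "(\<lambda>n. \<Prod>i = 0..<k. inverse (c + of_nat n + of_nat i)) \<longlonglongrightarrow> (\<Prod>i = 0..<k. 0)"
      by (intro tendsto_prod)
    then have "(\<lambda>n. pochhammer a k * pochhammer b k / fact k * (\<Prod>i = 0..<k. inverse (c + of_nat n + of_nat i)))
        \<longlonglongrightarrow> pochhammer a k * pochhammer b k / fact k * (\<Prod>i = 0..<k. 0)"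
      by (intro tendsto_mult tendsto_const)
    moreover have "pochhammer a k * pochhammer b k / fact k * (\<Prod>i = 0..<k. 0) = 0 ^ k"
      by (cases k) auto
    moreover have "pochhammer a k * pochhammer b k / fact k * (\<Prod>i = 0..<k. inverse (c + of_nat n + of_nat i)) =
        gauss_coeff a b (c + of_nat n) k" for n
      by (simp add: gauss_coeff_def pochhammer_prod[of "c + of_nat n"] divide_inverse mult_ac flip: prod_inversef[unfolded o_def])
    ultimately show ?thesis by simp
  qed
  \<comment> \<open>Here Re c > 0 enters: moving c + i to the right in the right half-plane
    increases its modulus, so each factor of the denominator grows.\<close>
  have le: "norm (gauss_coeff a b (c + of_nat n) k) \<le> norm (gauss_coeff a b c k)" for n k
  proof -
    have "norm (c + of_nat i) \<le> norm (c + of_nat n + of_nat i)" for i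
      unfolding cmod_def using assms(1)
      by (intro real_sqrt_le_mono add_mono) (auto intro!: power_mono)
    then have "norm (pochhammer c k) \<le> norm (pochhammer (c + of_nat n) k)"
      unfolding pochhammer_prod prod_norm[symmetric] by (intro prod_mono) auto
    moreover have "pochhammer c k \<noteq> 0"
      using c by (auto simp: pochhammer_eq_0_iff)
    ultimately show ?thesis
      unfolding gauss_coeff_def norm_mult norm_divide by (intro divide_left_mono mult_right_mono mult_pos_pos) (auto simp: norm_mult)
  qed
  have "((\<lambda>n. suminf (\<lambda>k. gauss_coeff a b (c + of_nat n) k)) \<longlongrightarrow> suminf (\<lambda>k. 0 ^ k)) sequentially"
    by (rule tannerys_theorem[where M = "\<lambda>k. norm (gauss_coeff a b c k)", THEN conjunct2, THEN conjunct2])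
       (use lim le gauss_coeff_summable[OF c assms(2)] in \<open>auto simp: split_def\<close>)
  then show ?thesis by (simp add: suminf_geometric)
qed

text \<open>Let n tend to infinity in \<open>gauss_sum_shift\<close>. The Pochhammer quotient
  converges because (c - a) + (c - b) = c + (c - a - b), and the shifted sum tends to 1.\<close>

theorem gauss_summation:
  assumes "Re c > 0" "Re (c - a - b) > 0"
  shows "(\<Sum>n. gauss_coeff a b c n) = rGamma (c - a) * rGamma (c - b) / (rGamma c * rGamma (c - a - b))"
proof -
  have c: "c \<notin> \<int>\<^sub>\<le>\<^sub>0" "c - a - b \<notin> \<int>\<^sub>\<le>\<^sub>0" using assms by (auto intro!: Re_pos_not_nonpos_Int)
  have "(\<lambda>n. pochhammer (c - a) n * pochhammer (c - b) n / (pochhammer c n * pochhammer (c - a - b) n) *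
      (\<Sum>k. gauss_coeff a b (c + of_nat n) k))
      \<longlonglongrightarrow> rGamma (c - a) * rGamma (c - b) / (rGamma c * rGamma (c - a - b)) * 1"
    by (intro tendsto_mult gauss_sum_shift_LIMSEQ pochhammer_ratio_LIMSEQ c assms) simp
  moreover have "pochhammer (c - a) n * pochhammer (c - b) n / (pochhammer c n * pochhammer (c - a - b) n) *
      (\<Sum>k. gauss_coeff a b (c + of_nat n) k) = (\<Sum>k. gauss_coeff a b c k)" for n
  proof -
    have "pochhammer c n \<noteq> 0" "pochhammer (c - a - b) n \<noteq> 0"
      using c by (auto simp: pochhammer_eq_0_iff)
    then show ?thesis
      using gauss_sum_shift[OF c(1) assms(2), of n] by (simp add: field_simps)
  qed
  ultimately show ?thesis by (simp add: LIMSEQ_const_iff)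
qed

subsection \<open>Boundary behaviour of Gauss series\<close>

text \<open>An Abelian theorem. With d = a - L b, the indices below some N contribute at most a
  constant C, as z < 1, and the others at most e/2 times B z. Because B tends to infinity at 1, the
  constant is negligible after division by B z.\<close>

lemma power_series_comparison:
  fixes a :: "nat \<Rightarrow> complex" and b :: "nat \<Rightarrow> real"
  assumes ratio: "(\<lambda>n. a n / of_real (b n)) \<longlonglongrightarrow> L" and b: "\<And>n. b n \<ge> 0" "\<forall>\<^sub>F n in sequentially. b n > 0"
    and B: "\<And>z. 0 < z \<Longrightarrow> z < 1 \<Longrightarrow> (\<lambda>n. b n * z ^ n) sums B z"
    and top: "filterlim B at_top (at_left (1::real))"
  shows "((\<lambda>z. (\<Sum>n. a n * of_real z ^ n) / of_real (B z)) \<longlongrightarrow> L) (at_left 1)"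
proof (rule tendstoI)
  fix e :: real assume e: "e > 0"
  define d where "d n = a n - L * of_real (b n)" for n
  have "\<forall>\<^sub>F n in sequentially. dist (a n / of_real (b n)) L < e / 2"
    using ratio e by (intro tendstoD) auto
  with b(2) have "\<forall>\<^sub>F n in sequentially. norm (d n) \<le> e / 2 * b n"
  proof eventually_elim
    case (elim n)
    have "d n = (a n / of_real (b n) - L) * of_real (b n)"
      using elim by (simp add: d_def field_simps)
    then have "norm (d n) = dist (a n / of_real (b n)) L * b n"
      using elim by (simp add: norm_mult dist_norm)
    then show ?case using elim by (simp add: mult_right_mono)
  qed
  then obtain N where N: "\<And>n. n \<ge> N \<Longrightarrow> norm (d n) \<le> e / 2 * b n"
    by (auto simp: eventually_at_top_linorder)
  define C where "C = (\<Sum>n<N. norm (d n))"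
  \<comment> \<open>The bound 2 C / e is what makes (C + e/2 B z) / B z smaller than e; the bound 0
    permits the division.\<close>
  have "\<forall>\<^sub>F z in at_left 1. B z > max 0 (2 * C / e)"
    using top unfolding filterlim_at_top_dense by blast
  moreover have "\<forall>\<^sub>F z in at_left 1. 0 < z \<and> z < (1::real)"
    unfolding eventually_at_left_field by (intro exI[of _ 0]) auto
  ultimately show "\<forall>\<^sub>F z in at_left 1. dist ((\<Sum>n. a n * of_real z ^ n) / of_real (B z)) L < e"
  proof eventually_elim
    case (elim z)
    define m where "m n = (if n < N then norm (d n) else 0) + e / 2 * (b n * z ^ n)" for n
    have "m sums (C + e / 2 * B z)"
      unfolding m_def C_def using B[of z] elim sums_If_finite_set[of "{..<N}" "\<lambda>n. norm (d n)"]
      by (intro sums_add sums_mult) auto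
    moreover have le: "norm (d n * of_real z ^ n) \<le> m n" for n
    proof -
      have "norm (d n * of_real z ^ n) = norm (d n) * z ^ n" using elim by (simp add: norm_mult norm_power)
      also have "\<dots> \<le> m n"
      proof (cases "n < N")
        case True
        have "norm (d n) * z ^ n \<le> norm (d n) * 1"
          using elim by (intro mult_left_mono power_le_one) auto
        then show ?thesis using True e b(1)[of n] elim by (simp add: m_def add_increasing2)
      next
        case False
        then have "norm (d n) * z ^ n \<le> (e / 2 * b n) * z ^ n"
          using N[of n] elim by (intro mult_right_mono) auto
        then show ?thesis using False by (simp add: m_def)
      qed
      finally show ?thesis .
    qed
    ultimately have sd: "summable (\<lambda>n. d n * of_real z ^ n)" and
      nd: "norm (\<Sum>n. d n * of_real z ^ n) \<le> C + e / 2 * B z"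
      using norm_suminf_le[of "\<lambda>n. d n * of_real z ^ n" m]
      by (auto intro: summable_comparison_test' simp: sums_iff)
    have "(\<lambda>n. complex_of_real (b n * z ^ n)) sums of_real (B z)"
      using B[of z] elim by (simp only: sums_of_real_iff)
    then have "(\<lambda>n. d n * of_real z ^ n + L * of_real (b n * z ^ n)) sums
        ((\<Sum>n. d n * of_real z ^ n) + L * of_real (B z))"
      using sd by (intro sums_add sums_mult summable_sums)
    then have "(\<Sum>n. a n * of_real z ^ n) = (\<Sum>n. d n * of_real z ^ n) + L * of_real (B z)"
      by (simp add: sums_iff d_def algebra_simps)
    then have "(\<Sum>n. a n * of_real z ^ n) / of_real (B z) - L = (\<Sum>n. d n * of_real z ^ n) / of_real (B z)"
      using elim by (simp add: field_simps)
    then have "dist ((\<Sum>n. a n * of_real z ^ n) / of_real (B z)) L = norm (\<Sum>n. d n * of_real z ^ n) / B z"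
      using elim by (simp add: dist_norm norm_divide)
    also have "\<dots> \<le> (C + e / 2 * B z) / B z" using nd elim by (intro divide_right_mono) auto
    also have "\<dots> < e" using elim e by (simp add: field_simps)
    finally show ?case .
  qed
qed

section \<open>The three regimes c < a + b, c = a + b and c > a + b (in real parts)\<close>

lemma sums_one_minus_powr:
  fixes d z :: real
  assumes "\<bar>z\<bar> < 1"
  shows "(\<lambda>n. pochhammer d n / fact n * z ^ n) sums (1 - z) powr (- d)"
proof -
  have "(\<lambda>n. ((- d) gchoose n) * (- z) ^ n) sums (1 + (- z)) powr (- d)"
    by (rule gen_binomial_real) (use assms in simp)
  moreover have "((- d) gchoose n) * (- z) ^ n = pochhammer d n / fact n * z ^ n" for n
    by (simp add: gbinomial_pochhammer flip: power_mult_distrib)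
  ultimately show ?thesis by simp
qed

text \<open>Compare with the binomial series of (1 - z)^(-d), whose coefficients are (d)_n / n!. The
  factorials cancel in the ratio of coefficients, and a + b = c + d is just the condition of
  \<open>pochhammer_ratio_LIMSEQ\<close>.\<close>

lemma gauss_series_tendsto_powr:
  fixes d :: real
  assumes "d > 0" "a + b = c + of_real d" "c \<notin> \<int>\<^sub>\<le>\<^sub>0"
  shows "((\<lambda>z. of_real ((1 - z) powr d) * (\<Sum>n. gauss_coeff a b c n * of_real z ^ n)) \<longlongrightarrow>
    rGamma a * rGamma b / (rGamma c * rGamma (of_real d))) (at_left 1)"
proof -
  have d: "complex_of_real d \<notin> \<int>\<^sub>\<le>\<^sub>0" using assms(1) by (intro Re_pos_not_nonpos_Int) simp
  have "((\<lambda>z. (\<Sum>n. gauss_coeff a b c n * of_real z ^ n) / of_real ((1 - z) powr (- d))) \<longlongrightarrow>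
    rGamma a * rGamma b / (rGamma c * rGamma (of_real d))) (at_left 1)"
  proof (rule power_series_comparison[where b = "\<lambda>n. pochhammer d n / fact n"])
    show "(\<lambda>n. gauss_coeff a b c n / of_real (pochhammer d n / fact n))
        \<longlonglongrightarrow> rGamma a * rGamma b / (rGamma c * rGamma (of_real d))"
      using pochhammer_ratio_LIMSEQ[OF assms(2,3) d]
      by (simp add: gauss_coeff_def pochhammer_of_real)
    show "0 \<le> pochhammer d n / fact n" for n using assms(1) by (simp add: pochhammer_nonneg)
    show "\<forall>\<^sub>F n in sequentially. 0 < pochhammer d n / fact n" using assms(1) by (simp add: pochhammer_pos)
    show "(\<lambda>n. pochhammer d n / fact n * z ^ n) sums (1 - z) powr (- d)" if "0 < z" "z < 1" for z
      using that by (intro sums_one_minus_powr) simp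
    show "filterlim (\<lambda>z. (1 - z) powr (- d)) at_top (at_left 1)"
      using assms(1) by real_asymp
  qed
  then show ?thesis by (simp add: powr_minus mult.commute divide_inverse)
qed

text \<open>For a + b = c the compensating factor of \<open>gauss_coeff_LIMSEQ\<close> is n itself,
  so the coefficients are compared with those of -ln (1 - z). At n = 0 the value 1 / 0 = 0 is
  correct, since that series has no constant term.\<close>

lemma gauss_series_tendsto_ln:
  assumes "c \<notin> \<int>\<^sub>\<le>\<^sub>0" "a + b = c"
  shows "((\<lambda>z. (\<Sum>n. gauss_coeff a b c n * of_real z ^ n) / of_real (- ln (1 - z))) \<longlongrightarrow>
    rGamma a * rGamma b / rGamma c) (at_left 1)"
proof (rule power_series_comparison[where b = "\<lambda>n. 1 / real n"])
  have "(\<lambda>n. gauss_coeff a b c (Suc n) * exp (of_real (ln (of_nat n))))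
           \<longlonglongrightarrow> rGamma a * rGamma b / rGamma c"
    using gauss_coeff_LIMSEQ[OF assms(1), of a b] by (simp flip: assms(2))
  \<comment> \<open>The factor (n + 1) / n repairs the index: the asymptotics multiply coefficient n
    + 1 by n, the comparison series needs n + 1.\<close>
  then have "(\<lambda>n. gauss_coeff a b c (Suc n) * exp (of_real (ln (of_nat n))) * of_real (real (Suc n) / real n))
           \<longlonglongrightarrow> rGamma a * rGamma b / rGamma c * of_real 1"
    by (intro tendsto_intros LIMSEQ_Suc_n_over_n)
  moreover have "\<forall>\<^sub>F n in sequentially. gauss_coeff a b c (Suc n) * exp (of_real (ln (of_nat n))) * of_real (real (Suc n) / real n) =
      gauss_coeff a b c (Suc n) / of_real (1 / real (Suc n))"
    using eventually_gt_at_top[of 0] by eventually_elim (simp add: exp_of_real)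
  ultimately have "(\<lambda>n. gauss_coeff a b c (Suc n) / of_real (1 / real (Suc n))) \<longlonglongrightarrow> rGamma a * rGamma b / rGamma c"
    by (simp add: tendsto_cong)
  then show "(\<lambda>n. gauss_coeff a b c n / of_real (1 / real n)) \<longlonglongrightarrow> rGamma a * rGamma b / rGamma c"
    by (simp only: filterlim_sequentially_Suc[of "\<lambda>n. gauss_coeff a b c n / of_real (1 / real n)"])
  show "\<forall>\<^sub>F n in sequentially. 0 < 1 / real n"
    using eventually_gt_at_top[of 0] by eventually_elim simp
  show "(\<lambda>n. 1 / real n * z ^ n) sums - ln (1 - z)" if "0 < z" "z < 1" for z
    using sums_minus[OF ln_series'[of "- z"]] that by simp
  show "filterlim (\<lambda>z::real. - ln (1 - z)) at_top (at_left 1)" by real_asymp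
qed auto

text \<open>The coefficients are absolutely summable, so they dominate the series for 0 < z < 1 and
  the limit can be taken termwise; \<open>gauss_summation\<close> evaluates the result.\<close>

lemma gauss_series_tendsto_gauss_sum:
  assumes "Re c > 0" "Re (c - a - b) > 0"
  shows "((\<lambda>z. \<Sum>n. gauss_coeff a b c n * of_real z ^ n) \<longlongrightarrow>
    rGamma (c - a) * rGamma (c - b) / (rGamma c * rGamma (c - a - b))) (at_left 1)"
proof -
  have c: "c \<notin> \<int>\<^sub>\<le>\<^sub>0" using assms(1) by (intro Re_pos_not_nonpos_Int) simp
  have "((\<lambda>z. \<Sum>n. gauss_coeff a b c n * of_real z ^ n) \<longlongrightarrow> (\<Sum>n. gauss_coeff a b c n)) (at_left 1)"
  proof (rule tannerys_theorem[THEN conjunct2, THEN conjunct2])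
    show "((\<lambda>z. gauss_coeff a b c n * of_real z ^ n) \<longlongrightarrow> gauss_coeff a b c n) (at_left 1)" for n
      by (auto intro!: tendsto_eq_intros)
    have "\<forall>\<^sub>F z in at_left 1. 0 < z \<and> z < (1::real)"
      unfolding eventually_at_left_field by (intro exI[of _ 0]) auto
    then show "\<forall>\<^sub>F (n, z) in sequentially \<times>\<^sub>F at_left 1. norm (gauss_coeff a b c n * of_real z ^ n) \<le> norm (gauss_coeff a b c n)"
      unfolding eventually_prod_filter
      by (intro exI[of _ "\<lambda>_. True"] exI[of _ "\<lambda>z. 0 < z \<and> z < 1"])
         (auto simp: norm_mult norm_power intro!: mult_left_le power_le_one)
  qed (use gauss_coeff_summable[OF c assms(2)] in auto)
  then show ?thesis by (simp add: gauss_summation[OF assms])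
qed

subsection \<open>Moments\<close>

text \<open>Passes from sets to functions by the standard induction on nonnegative measurable
  functions. In the supremum step the two suprema add because both sequences of integrals
  increase.\<close>

lemma nn_integral_sum_of_measures:
  assumes sets: "sets N = sets M" and f: "f \<in> borel_measurable M"
  shows "(\<integral>\<^sup>+x. f x \<partial>sum_of_measures M N) = (\<integral>\<^sup>+x. f x \<partial>M) + (\<integral>\<^sup>+x. f x \<partial>N)"
proof -
  have mS: "g \<in> borel_measurable (sum_of_measures M N)" and mN: "g \<in> borel_measurable N"
    if "g \<in> borel_measurable M" for g :: "'a \<Rightarrow> ennreal"
    using that measurable_cong_sets[OF sets refl] measurable_cong_sets[OF sets_sum_of_measures refl] by blast+
  have space: "space N = space M" using sets by (rule sets_eq_imp_space_eq)
  show ?thesis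
    using f
  proof induction
    case (cong f g)
    then show ?case
      using nn_integral_cong[of M f g] nn_integral_cong[of N f g] nn_integral_cong[of "sum_of_measures M N" f g]
      by (simp add: space)
  next
    case (set A)
    then show ?case using sets by (simp add: emeasure_sum_of_measures)
  next
    case (mult g c)
    then show ?case by (simp add: nn_integral_cmult mS mN distrib_left)
  next
    case (add g h)
    then show ?case by (simp add: nn_integral_add mS mN add_ac)
  next
    case (seq U)
    have inc: "incseq (\<lambda>i. \<integral>\<^sup>+x. U i x \<partial>K)" for K
      using seq(3) by (auto simp: incseq_def le_fun_def intro!: nn_integral_mono)
    show ?case
      unfolding SUP_apply image_comp
      using seq by (simp add: nn_integral_monotone_convergence_SUP mS mN inc ennreal_SUP_add)
  qed
qed

section \<open>Beta integrals and their substitution\<close>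

lemma Beta_Suc:
  fixes p :: real
  assumes "p > 0"
  shows "Beta p (real n + 1) = fact n / pochhammer p (Suc n)"
proof -
  have "p \<notin> \<int>\<^sub>\<le>\<^sub>0" using assms by (auto elim!: nonpos_Ints_cases)
  then have "pochhammer p (Suc n) = Gamma (p + (real n + 1)) / Gamma p"
    using pochhammer_Gamma[of p "Suc n"] by (simp add: add_ac)
  moreover have "Gamma (real n + 1) = fact n" by (metis Gamma_fact add.commute)
  ultimately show ?thesis by (simp add: Beta_def)
qed

lemma has_integral_powr_times_power:
  fixes p :: real
  assumes "p > 0"
  shows "((\<lambda>y. y powr (p - 1) * (1 - y) ^ n) has_integral (fact n / pochhammer p (Suc n))) {0<..1}"
proof -
  have "((\<lambda>y. y powr (p - 1) * (1 - y) powr (real n + 1 - 1)) has_integral Beta p (real n + 1)) {0..1}"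
    by (rule has_integral_Beta_real) (use assms in auto)
  \<comment> \<open>For n = 0 the integrands differ at y = 1, where 0 \<open>powr\<close> 0 is 0 but
    0 ^ 0 is 1.\<close>
  then have "((\<lambda>y. y powr (p - 1) * (1 - y) ^ n) has_integral Beta p (real n + 1)) {0..1}"
    by (rule has_integral_spike_finite[of "{1}", rotated 2]) (auto simp: powr_realpow)
  then have "((\<lambda>y. y powr (p - 1) * (1 - y) ^ n) has_integral Beta p (real n + 1)) {0<..1}"
  proof (rule has_integral_spike_set_eq[THEN iffD1, rotated 2])
    show "negligible {y \<in> {0..1} - {0<..1}. y powr (p - 1) * (1 - y) ^ n \<noteq> 0}"
      by (rule negligible_subset[of "{0}"]) auto
    show "negligible {y \<in> {0<..1} - {0..1}. y powr (p - 1) * (1 - y) ^ n \<noteq> 0}"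
      by (rule negligible_subset[of "{0}"]) auto
  qed
  then show ?thesis by (simp only: Beta_Suc[OF assms])
qed

lemma nn_integral_powr_times_one_minus_powr:
  fixes p q \<gamma> :: real
  assumes "p > 0" "q > 0" "\<gamma> > 0"
  shows "(\<integral>\<^sup>+x. ennreal (x powr (\<gamma> * p - 1) * (1 - q * x powr \<gamma>) ^ n) * indicator {0<..q powr (- (1 / \<gamma>))} x \<partial>lborel) =
    ennreal (fact n / (\<gamma> * q powr p * pochhammer p (Suc n)))"
proof -
  define X where "X = q powr (- (1 / \<gamma>))"
  define g where "g x = q * x powr \<gamma>" for x
  define f where "f y = y powr (p - 1) * (1 - y) ^ n" for y
  have X: "X > 0" using assms by (simp add: X_def)
  have gX: "g X = 1"
  proof -
    have "X powr \<gamma> = q powr (- 1)" using assms by (simp add: X_def powr_powr)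
    then show ?thesis using assms by (simp add: g_def powr_neg_one)
  qed
  have g_le: "g x \<le> 1" "g x > 0" if "x \<in> {0<..X}" for x
  proof -
    have "g x \<le> g X" unfolding g_def using that assms by (intro mult_left_mono powr_mono2) auto
    then show "g x \<le> 1" by (simp add: gX)
    show "g x > 0" using that assms by (simp add: g_def)
  qed
  have inj: "inj_on g {0<..X}"
  proof (rule inj_onI)
    fix x y assume "x \<in> {0<..X}" "y \<in> {0<..X}" "g x = g y"
    then have "(x powr \<gamma>) powr (1 / \<gamma>) = (y powr \<gamma>) powr (1 / \<gamma>)" using assms by (simp add: g_def)
    then show "x = y" using \<open>x \<in> _\<close> \<open>y \<in> _\<close> assms by (simp add: powr_powr)
  qed
  have img: "g ` {0<..X} = {0<..1}"
  proof safe
    fix y :: real assume y: "y \<in> {0<..1}"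
    define x where "x = (y / q) powr (1 / \<gamma>)"
    have "g x = y" using y assms by (simp add: g_def x_def powr_powr)
    moreover have "x \<le> (1 / q) powr (1 / \<gamma>)" unfolding x_def using y assms
      by (intro powr_mono2) (auto simp: divide_right_mono)
    then have "x \<le> X" using assms by (simp add: X_def powr_divide powr_minus_divide)
    moreover have "x > 0" using y assms by (simp add: x_def)
    ultimately show "y \<in> g ` {0<..X}" by (intro image_eqI[of _ _ x]) auto
  qed (use g_le in auto)
  have der: "(g has_real_derivative q * (\<gamma> * x powr (\<gamma> - 1))) (at x within {0<..X})" if "x \<in> {0<..X}" for x
    unfolding g_def using that by (auto intro!: derivative_eq_intros)
  have "f absolutely_integrable_on {0<..1} \<and> integral {0<..1} f = fact n / pochhammer p (Suc n)"
    using has_integral_powr_times_power[OF assms(1), of n] unfolding f_def[symmetric]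
    by (auto intro!: nonnegative_absolutely_integrable_1 simp: has_integral_iff) (auto simp: f_def)
  then have "(\<lambda>x. \<bar>q * (\<gamma> * x powr (\<gamma> - 1))\<bar> * f (g x)) absolutely_integrable_on {0<..X} \<and>
      integral {0<..X} (\<lambda>x. \<bar>q * (\<gamma> * x powr (\<gamma> - 1))\<bar> * f (g x)) = fact n / pochhammer p (Suc n)"
    unfolding img[symmetric]
    using der inj by (subst has_absolute_integral_change_of_variables_1'[where g = g]) auto
  then have "((\<lambda>x. \<bar>q * (\<gamma> * x powr (\<gamma> - 1))\<bar> * f (g x)) has_integral fact n / pochhammer p (Suc n)) {0<..X}"
    by (auto simp: has_integral_iff dest: set_lebesgue_integral_eq_integral)
  \<comment> \<open>The Jacobian contributes \<gamma> q and y^(p-1) contributes q^(p-1); dividing by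
    \<gamma> q^p leaves the pure power x^(\<gamma> p - 1).\<close>
  then have "((\<lambda>x. \<bar>q * (\<gamma> * x powr (\<gamma> - 1))\<bar> * f (g x) / (\<gamma> * q powr p)) has_integral
      (fact n / pochhammer p (Suc n)) / (\<gamma> * q powr p)) {0<..X}"
    by (rule has_integral_divide)
  moreover have "\<bar>q * (\<gamma> * x powr (\<gamma> - 1))\<bar> * f (g x) / (\<gamma> * q powr p) =
      x powr (\<gamma> * p - 1) * (1 - q * x powr \<gamma>) ^ n" if "x \<in> {0<..X}" for x
  proof -
    have "q * q powr (p - 1) = q powr p" using assms by (simp add: powr_diff)
    moreover have "x powr (\<gamma> - 1) * (x powr \<gamma>) powr (p - 1) = x powr (\<gamma> * p - 1)"
      using that by (simp add: powr_powr flip: powr_add) (simp add: algebra_simps)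
    moreover have "\<bar>q * (\<gamma> * x powr (\<gamma> - 1))\<bar> * f (g x) / (\<gamma> * q powr p) =
      (q * q powr (p - 1)) / q powr p * (x powr (\<gamma> - 1) * (x powr \<gamma>) powr (p - 1)) * (1 - q * x powr \<gamma>) ^ n"
      using assms that by (simp add: f_def g_def powr_mult abs_mult)
    ultimately show ?thesis using assms by simp
  qed
  ultimately have "((\<lambda>x. x powr (\<gamma> * p - 1) * (1 - q * x powr \<gamma>) ^ n) has_integral
      fact n / pochhammer p (Suc n) / (\<gamma> * q powr p)) {0<..X}"
    by (rule has_integral_eq[rotated]) auto
  from nn_integral_has_integral_lebesgue[OF _ this]
  have "(\<integral>\<^sup>+x. ennreal (indicator {0<..X} x * (x powr (\<gamma> * p - 1) * (1 - q * x powr \<gamma>) ^ n)) \<partial>lborel) =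
      ennreal (fact n / pochhammer p (Suc n) / (\<gamma> * q powr p))"
    using g_le unfolding g_def by fastforce
  moreover have "(\<integral>\<^sup>+x. ennreal (x powr (\<gamma> * p - 1) * (1 - q * x powr \<gamma>) ^ n) * indicator {0<..X} x \<partial>lborel) =
      (\<integral>\<^sup>+x. ennreal (indicator {0<..X} x * (x powr (\<gamma> * p - 1) * (1 - q * x powr \<gamma>) ^ n)) \<partial>lborel)"
    by (intro nn_integral_cong) (auto split: split_indicator)
  ultimately show ?thesis unfolding X_def[symmetric] by (simp add: mult_ac)
qed

text \<open>The coefficients of F(a,b,p,.) with the numerator written as the product of (a + k)(b +
  k), which makes them visibly real; the counterpart of \<open>hcoeff\<close> for unshifted a and
  b.\<close>

definition rcoeff :: "real \<Rightarrow> real \<Rightarrow> real \<Rightarrow> nat \<Rightarrow> real" where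
  "rcoeff \<theta> \<gamma> p n = (\<Prod>k<n. (real k)\<^sup>2 + 2 * real k / \<gamma> + \<theta> / \<gamma>\<^sup>2) / (pochhammer p n * fact n)"

lemma gauss_coeff_eq_rcoeff:
  assumes "\<gamma> > 0"
  shows "gauss_coeff (sigma1 \<theta> / of_real \<gamma>) (sigma2 \<theta> / of_real \<gamma>) (of_real p) n = of_real (rcoeff \<theta> \<gamma> p n)"
proof -
  have *: "(sigma1 \<theta> / of_real \<gamma> + of_nat k) * (sigma2 \<theta> / of_real \<gamma> + of_nat k) =
      of_real ((real k)\<^sup>2 + 2 * real k / \<gamma> + \<theta> / \<gamma>\<^sup>2)" for k
  proof -
    have "(sigma1 \<theta> / of_real \<gamma> + of_nat k) * (sigma2 \<theta> / of_real \<gamma> + of_nat k) =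
      (of_nat k)\<^sup>2 + of_nat k * (sigma1 \<theta> + sigma2 \<theta>) / of_real \<gamma>
        + sigma1 \<theta> * sigma2 \<theta> / (of_real \<gamma>)\<^sup>2"
      using assms by (simp add: field_simps power2_eq_square)
    then show ?thesis by (simp add: sigma_sum sigma_prod algebra_simps)
  qed
  have "pochhammer (sigma1 \<theta> / of_real \<gamma>) n * pochhammer (sigma2 \<theta> / of_real \<gamma>) n =
      of_real (\<Prod>k<n. (real k)\<^sup>2 + 2 * real k / \<gamma> + \<theta> / \<gamma>\<^sup>2)"
    unfolding pochhammer_prod prod.distrib[symmetric] of_real_prod *
    by (simp add: atLeast0LessThan)
  then show ?thesis by (simp add: gauss_coeff_def rcoeff_def pochhammer_of_real)
qed

lemma rcoeff_nonneg:
  assumes "\<theta> > 0" "\<gamma> > 0" "p > 0"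
  shows "rcoeff \<theta> \<gamma> p n \<ge> 0"
  unfolding rcoeff_def using assms
  by (intro divide_nonneg_nonneg prod_nonneg mult_nonneg_nonneg pochhammer_nonneg) auto

text \<open>The factor for k = 0 is a b = \<theta>/\<gamma>^2, and the remaining factors are those
  of \<open>hcoeff\<close>. The last quotient is the Beta integral of
  \<open>has_integral_powr_times_power\<close>, so integrating term n of the density yields
  coefficient n + 1 of the moment.\<close>

lemma rcoeff_Suc:
  "rcoeff \<theta> \<gamma> p (Suc n) = \<theta> / \<gamma>\<^sup>2 * hcoeff \<theta> \<gamma> n * (fact n / pochhammer p (Suc n))"
  unfolding rcoeff_def hcoeff_def prod.lessThan_Suc_shift
  by (simp add: mult_ac add_ac del: fact_Suc)

lemma hyp2F1_eq_gauss_series: "hyp2F1 a b c z = (\<Sum>n. gauss_coeff a b c n * z ^ n)"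
  by (simp add: hyp2F1_def eval_fps_def gauss_coeff_def)

lemma hcoeff_sums:
  assumes "\<theta> > 0" "\<gamma> > 0" "0 \<le> z" "z < 1"
  shows "(\<lambda>n. hcoeff \<theta> \<gamma> n * z ^ n) sums
    Re (hyp2F1 (1 + sigma1 \<theta> / of_real \<gamma>) (1 + sigma2 \<theta> / of_real \<gamma>) 2 (of_real z))"
proof -
  let ?F = "fps_hypergeo [1 + sigma1 \<theta> / of_real \<gamma>, 1 + sigma2 \<theta> / of_real \<gamma>] [2] (1::complex)"
  have "summable (\<lambda>n. fps_nth ?F n * of_real z ^ n)"
    by (rule summable_fps) (use assms hypergeo_conv_radius[of \<theta> \<gamma>] in simp)
  then have "(\<lambda>n. fps_nth ?F n * of_real z ^ n) sums eval_fps ?F (of_real z)"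
    unfolding eval_fps_def by (rule summable_sums)
  then have "(\<lambda>n. Re (fps_nth ?F n * of_real z ^ n)) sums Re (eval_fps ?F (of_real z))"
    by (rule sums_Re)
  then show ?thesis
    unfolding hypergeo_coeff[OF assms(2)] hyp2F1_def by (simp flip: of_real_power)
qed

text \<open>The Beta factor n! / (p)_{n+1} is at most 1/p, so the convergent series of
  \<open>hcoeff\<close> is a majorant.\<close>

lemma rcoeff_summable:
  assumes "\<theta> > 0" "\<gamma> > 0" "p > 0" "0 \<le> z" "z < 1"
  shows "summable (\<lambda>n. rcoeff \<theta> \<gamma> p n * z ^ n)"
proof -
  have "summable (\<lambda>n. \<theta> / \<gamma>\<^sup>2 / p * z * (hcoeff \<theta> \<gamma> n * z ^ n))"
    using hcoeff_sums[OF assms(1,2,4,5)] by (intro summable_mult) (rule sums_summable)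
  then have "summable (\<lambda>n. rcoeff \<theta> \<gamma> p (Suc n) * z ^ Suc n)"
  proof (rule summable_comparison_test'[where N = 0])
    fix n
    have "fact n \<le> pochhammer (p + 1) n"
      unfolding pochhammer_fact pochhammer_prod using assms by (intro prod_mono) auto
    then have "fact n / pochhammer p (Suc n) \<le> 1 / p"
      unfolding pochhammer_rec using assms pochhammer_pos[of "p + 1" n] by (simp add: field_simps)
    then have "rcoeff \<theta> \<gamma> p (Suc n) \<le> \<theta> / \<gamma>\<^sup>2 * hcoeff \<theta> \<gamma> n * (1 / p)"
      unfolding rcoeff_Suc using assms hcoeff_pos[OF assms(1,2), of n] by (intro mult_left_mono) auto
    then have "rcoeff \<theta> \<gamma> p (Suc n) * z ^ Suc n \<le> \<theta> / \<gamma>\<^sup>2 * hcoeff \<theta> \<gamma> n * (1 / p) * z ^ Suc n"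
      using assms by (intro mult_right_mono) auto
    then show "norm (rcoeff \<theta> \<gamma> p (Suc n) * z ^ Suc n) \<le> \<theta> / \<gamma>\<^sup>2 / p * z * (hcoeff \<theta> \<gamma> n * z ^ n)"
      using assms rcoeff_nonneg[OF assms(1-3), of "Suc n"] by (simp add: abs_mult mult_ac)
  qed
  then show ?thesis by (simp only: summable_Suc_iff[of "\<lambda>n. rcoeff \<theta> \<gamma> p n * z ^ n"])
qed

section \<open>The moments as Gauss series\<close>

lemma nn_integral_u:
  assumes "f \<in> borel_measurable borel"
  shows "(\<integral>\<^sup>+x. f x \<partial>u \<theta> \<gamma> t) =
    ennreal ((1 - \<gamma> * t) powr (1 / \<gamma>)) * (f ((1 - \<gamma> * t) powr (- (1 / \<gamma>))) * indicator {0<..} ((1 - \<gamma> * t) powr (- (1 / \<gamma>)))) +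
    (\<integral>\<^sup>+x. ennreal (uR \<theta> \<gamma> t x * heaviside (1 - (1 - \<gamma> * t) powr (1 / \<gamma>) * x)) * (f x * indicator {0<..} x) \<partial>lborel)"
proof -
  have [measurable]: "f \<in> borel_measurable borel" by fact
  have [simp]: "borel_measurable (scale_measure c (return borel y)) = (borel_measurable borel :: (real \<Rightarrow> ennreal) set)"
    for c and y :: real
    by (rule measurable_cong_sets) simp_all
  show ?thesis
    unfolding u_def
    by (subst nn_integral_restrict_space, simp, subst nn_integral_sum_of_measures)
       (simp_all add: nn_integral_scale_measure nn_integral_return nn_integral_density)
qed

text \<open>The interchange of sum and integral takes place in \<open>ennreal\<close>, where
  nonnegative terms suffice; finiteness comes afterwards from \<open>rcoeff_summable\<close>. The
  condition r > -1 is p > 0, the integrability of x^r at 0.\<close>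

lemma moment_u:
  assumes "\<theta> > 0" "\<gamma> > 0" "0 < t" "t < 1 / \<gamma>" "r > - 1"
  shows "(\<integral>x. x powr r \<partial>u \<theta> \<gamma> t) =
    (1 - \<gamma> * t) powr ((1 - r) / \<gamma>) * (\<Sum>n. rcoeff \<theta> \<gamma> ((r + 1) / \<gamma>) n * (\<gamma> * t) ^ n)"
proof -
  define q s p X where "q = 1 - \<gamma> * t" and "s = \<gamma> * t" and "p = (r + 1) / \<gamma>" and "X = q powr (- (1 / \<gamma>))"
  have s: "0 < s" "s < 1" using assms by (auto simp: s_def field_simps)
  have q: "0 < q" "q < 1" using s by (auto simp: q_def s_def)
  have p: "p > 0" "\<gamma> * p = r + 1" using assms by (auto simp: p_def)
  have X: "X > 0" "q powr (1 / \<gamma>) * X = 1" using q by (auto simp: X_def powr_minus)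
  define c where "c = \<theta> * q powr (2 / \<gamma>) * t"
  have c: "c > 0" using assms q by (simp add: c_def)
  have integrand: "ennreal (uR \<theta> \<gamma> t x * heaviside (1 - q powr (1 / \<gamma>) * x)) * (ennreal (x powr r) * indicator {0<..} x) =
      (\<Sum>n. ennreal (c * hcoeff \<theta> \<gamma> n * s ^ n) * (ennreal (x powr r * (1 - q * x powr \<gamma>) ^ n) * indicator {0<..X} x))" for x
  proof (cases "x \<in> {0<..X}")
    case True
    have "q powr (1 / \<gamma>) * x \<le> q powr (1 / \<gamma>) * X" using True by (intro mult_left_mono) auto
    then have le: "q powr (1 / \<gamma>) * x \<le> 1" by (simp add: X)
    define z where "z = \<gamma> * t * (1 + (\<gamma> * t - 1) * x powr \<gamma>)"
    have z: "0 \<le> z" "z < 1"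
      using heaviside_arg[OF assms(2-4)] True le unfolding z_def q_def by auto
    \<comment> \<open>This factorisation turns z^n into s^n times the integrand of the Beta
      integral.\<close>
    have z_eq: "z = s * (1 - q * x powr \<gamma>)" by (simp add: z_def s_def q_def algebra_simps)
    then have nn: "0 \<le> 1 - q * x powr \<gamma>" using z s by (simp add: zero_le_mult_iff)
    have "(\<lambda>n. c * x powr r * (hcoeff \<theta> \<gamma> n * z ^ n)) sums (c * x powr r *
        Re (hyp2F1 (1 + sigma1 \<theta> / of_real \<gamma>) (1 + sigma2 \<theta> / of_real \<gamma>) 2 (of_real z)))"
      by (intro sums_mult hcoeff_sums assms z)
    then have "(\<lambda>n. c * x powr r * (hcoeff \<theta> \<gamma> n * z ^ n)) sums (uR \<theta> \<gamma> t x * x powr r)"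
      unfolding uR_def c_def q_def[symmetric] z_def[symmetric] by (simp only: mult_ac)
    then have "(\<Sum>n. ennreal (c * x powr r * (hcoeff \<theta> \<gamma> n * z ^ n))) = ennreal (uR \<theta> \<gamma> t x * x powr r)"
      using c z hcoeff_pos[OF assms(1,2)] by (intro suminf_ennreal_eq) (simp_all add: less_imp_le)
    moreover have "ennreal (c * x powr r * (hcoeff \<theta> \<gamma> n * z ^ n)) =
        ennreal (c * hcoeff \<theta> \<gamma> n * s ^ n) * ennreal (x powr r * (1 - q * x powr \<gamma>) ^ n)" for n
      using c s hcoeff_pos[OF assms(1,2), of n]
      by (subst ennreal_mult'[symmetric]) (simp_all add: z_eq power_mult_distrib mult_ac)
    ultimately show ?thesis
      using True le by (simp add: heaviside_def ennreal_mult'')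
  next
    case False
    then consider "x \<le> 0" | "x > X" "x > 0" using X by fastforce
    then show ?thesis
    proof cases
      case 2
      then have "q powr (1 / \<gamma>) * X < q powr (1 / \<gamma>) * x" using q by (intro mult_strict_left_mono) auto
      then show ?thesis using False by (simp add: X heaviside_def)
    qed (use False in auto)
  qed
  have integral_term: "(\<integral>\<^sup>+x. ennreal (c * hcoeff \<theta> \<gamma> n * s ^ n) * (ennreal (x powr r * (1 - q * x powr \<gamma>) ^ n) * indicator {0<..X} x) \<partial>lborel) =
      ennreal (q powr ((1 - r) / \<gamma>) * (rcoeff \<theta> \<gamma> p (Suc n) * s ^ Suc n))" for n
  proof -
    have "(\<integral>\<^sup>+x. ennreal (c * hcoeff \<theta> \<gamma> n * s ^ n) * (ennreal (x powr r * (1 - q * x powr \<gamma>) ^ n) * indicator {0<..X} x) \<partial>lborel) =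
       ennreal (c * hcoeff \<theta> \<gamma> n * s ^ n) * (\<integral>\<^sup>+x. ennreal (x powr r * (1 - q * x powr \<gamma>) ^ n) * indicator {0<..X} x \<partial>lborel)"
      by (intro nn_integral_cmult) simp
    also have "\<dots> = ennreal (c * hcoeff \<theta> \<gamma> n * s ^ n) * ennreal (fact n / (\<gamma> * q powr p * pochhammer p (Suc n)))"
      using nn_integral_powr_times_one_minus_powr[OF p(1) q(1) assms(2), of n] by (simp only: p(2) X_def add_diff_cancel_right')
    also have "\<dots> = ennreal (c * hcoeff \<theta> \<gamma> n * s ^ n * (fact n / (\<gamma> * q powr p * pochhammer p (Suc n))))"
      using c s hcoeff_pos[OF assms(1,2), of n] by (intro ennreal_mult'[symmetric]) simp
    also have "c * hcoeff \<theta> \<gamma> n * s ^ n * (fact n / (\<gamma> * q powr p * pochhammer p (Suc n))) =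
        q powr ((1 - r) / \<gamma>) * (rcoeff \<theta> \<gamma> p (Suc n) * s ^ Suc n)"
    \<comment> \<open>The exponent is 2/\<gamma> - p = (1 - r)/\<gamma>. The factor t of
      \<open>uR\<close> with the 1/\<gamma> of the substitution gives t/\<gamma> = s/\<gamma>^2,
      which raises s^n to s^(n+1) and supplies the 1/\<gamma>^2 of
      \<open>rcoeff_Suc\<close>.\<close>
    proof -
      have "q powr (2 / \<gamma>) / q powr p = q powr ((1 - r) / \<gamma>)"
        unfolding powr_diff[symmetric] by (simp add: p_def flip: diff_divide_distrib)
      moreover have "c * hcoeff \<theta> \<gamma> n * s ^ n * (fact n / (\<gamma> * q powr p * pochhammer p (Suc n))) =
          (q powr (2 / \<gamma>) / q powr p) * (rcoeff \<theta> \<gamma> p (Suc n) * s ^ Suc n)"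
        unfolding rcoeff_Suc using assms by (simp add: c_def s_def power2_eq_square mult_ac)
      ultimately show ?thesis by simp
    qed
    finally show ?thesis .
  qed
  have sum: "summable (\<lambda>n. rcoeff \<theta> \<gamma> p n * s ^ n)"
    using rcoeff_summable[OF assms(1,2) p(1)] s by simp
  then have sum': "summable (\<lambda>n. rcoeff \<theta> \<gamma> p (Suc n) * s ^ Suc n)"
    by (simp only: summable_Suc_iff[of "\<lambda>n. rcoeff \<theta> \<gamma> p n * s ^ n"])
  have nonneg: "0 \<le> rcoeff \<theta> \<gamma> p n * s ^ n" for n
    using rcoeff_nonneg[OF assms(1,2) p(1)] s by simp
  have "(\<integral>\<^sup>+x. ennreal (x powr r) \<partial>u \<theta> \<gamma> t) =
      ennreal (q powr (1 / \<gamma>)) * ennreal (X powr r) +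
      (\<integral>\<^sup>+x. (\<Sum>n. ennreal (c * hcoeff \<theta> \<gamma> n * s ^ n) * (ennreal (x powr r * (1 - q * x powr \<gamma>) ^ n) * indicator {0<..X} x)) \<partial>lborel)"
    using X(1) by (subst nn_integral_u) (simp_all only: q_def[symmetric] X_def[symmetric] integrand, auto)
  also have "(\<integral>\<^sup>+x. (\<Sum>n. ennreal (c * hcoeff \<theta> \<gamma> n * s ^ n) * (ennreal (x powr r * (1 - q * x powr \<gamma>) ^ n) * indicator {0<..X} x)) \<partial>lborel) =
      (\<Sum>n. ennreal (q powr ((1 - r) / \<gamma>) * (rcoeff \<theta> \<gamma> p (Suc n) * s ^ Suc n)))"
    by (subst nn_integral_suminf) (auto simp: integral_term)
  also have "\<dots> = ennreal (\<Sum>n. q powr ((1 - r) / \<gamma>) * (rcoeff \<theta> \<gamma> p (Suc n) * s ^ Suc n))"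
    by (intro suminf_ennreal2 mult_nonneg_nonneg nonneg summable_mult sum') simp
  also have "(\<Sum>n. q powr ((1 - r) / \<gamma>) * (rcoeff \<theta> \<gamma> p (Suc n) * s ^ Suc n)) =
      q powr ((1 - r) / \<gamma>) * (\<Sum>n. rcoeff \<theta> \<gamma> p (Suc n) * s ^ Suc n)"
    by (rule suminf_mult[OF sum'])
  \<comment> \<open>The atom has mass q^(1/\<gamma>) and sits at X = q^(-1/\<gamma>), so it carries
    the same power of q as the integrated terms and serves as the coefficient 1 at n = 0.\<close>
  also have "ennreal (q powr (1 / \<gamma>)) * ennreal (X powr r) = ennreal (q powr ((1 - r) / \<gamma>))"
    using q by (simp add: X_def powr_powr diff_divide_distrib flip: ennreal_mult' powr_add)
  also have "ennreal (q powr ((1 - r) / \<gamma>)) + ennreal (q powr ((1 - r) / \<gamma>) * (\<Sum>n. rcoeff \<theta> \<gamma> p (Suc n) * s ^ Suc n)) =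
      ennreal (q powr ((1 - r) / \<gamma>) * (1 + (\<Sum>n. rcoeff \<theta> \<gamma> p (Suc n) * s ^ Suc n)))"
    using suminf_nonneg[OF sum' nonneg] by (subst ennreal_plus[symmetric]) (simp_all add: distrib_left)
  also have "1 + (\<Sum>n. rcoeff \<theta> \<gamma> p (Suc n) * s ^ Suc n) = (\<Sum>n. rcoeff \<theta> \<gamma> p n * s ^ n)"
    using suminf_split_head[OF sum] by (simp add: rcoeff_def)
  finally have nn: "(\<integral>\<^sup>+x. ennreal (x powr r) \<partial>u \<theta> \<gamma> t) =
      ennreal (q powr ((1 - r) / \<gamma>) * (\<Sum>n. rcoeff \<theta> \<gamma> p n * s ^ n))" .
  have "(\<lambda>x. x powr r) \<in> borel_measurable (u \<theta> \<gamma> t)"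
    unfolding measurable_cong_sets[OF sets_u refl] by (intro measurable_restrict_space1) simp
  \<comment> \<open>The finite value \<open>nn\<close> ensures that the Bochner integral is the
    moment itself and not the default 0 of a non-integrable function.\<close>
  then have "(\<integral>x. x powr r \<partial>u \<theta> \<gamma> t) = enn2real (\<integral>\<^sup>+x. ennreal (x powr r) \<partial>u \<theta> \<gamma> t)"
    by (intro integral_eq_nn_integral) auto
  also have "\<dots> = q powr ((1 - r) / \<gamma>) * (\<Sum>n. rcoeff \<theta> \<gamma> p n * s ^ n)"
    unfolding nn using suminf_nonneg[OF sum nonneg] by (intro enn2real_ennreal) simp
  finally show ?thesis by (simp add: q_def s_def p_def)
qed

lemma complex_moment_u:
  assumes "\<theta> > 0" "\<gamma> > 0" "0 < t" "t < 1 / \<gamma>" "r > - 1"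
  shows "complex_of_real (\<integral>x. x powr r \<partial>u \<theta> \<gamma> t) = of_real ((1 - \<gamma> * t) powr ((1 - r) / \<gamma>)) *
    (\<Sum>n. gauss_coeff (sigma1 \<theta> / of_real \<gamma>) (sigma2 \<theta> / of_real \<gamma>) (of_real ((r + 1) / \<gamma>)) n * of_real (\<gamma> * t) ^ n)"
proof -
  have "summable (\<lambda>n. rcoeff \<theta> \<gamma> ((r + 1) / \<gamma>) n * (\<gamma> * t) ^ n)"
    using assms by (intro rcoeff_summable) (auto simp: field_simps)
  from suminf_of_real[OF this, where 'a = complex] show ?thesis
    unfolding moment_u[OF assms] gauss_coeff_eq_rcoeff[OF assms(2)] by simp
qed

subsection \<open>Limits\<close>

lemma filterlim_mult_at_left_1:
  fixes \<gamma> :: real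
  assumes "\<gamma> > 0"
  shows "filterlim (\<lambda>t. \<gamma> * t) (at_left 1) (at_left (1 / \<gamma>))"
  unfolding filterlim_at
proof
  show "\<forall>\<^sub>F t in at_left (1 / \<gamma>). \<gamma> * t \<in> {..<1} \<and> \<gamma> * t \<noteq> 1"
    unfolding eventually_at_left_field using assms
    by (intro exI[of _ 0]) (auto simp: field_simps)
  show "((\<lambda>t. \<gamma> * t) \<longlongrightarrow> 1) (at_left (1 / \<gamma>))"
    using assms by (auto intro!: tendsto_eq_intros)
qed

lemma eventually_at_left_inverse:
  fixes \<gamma> :: real
  assumes "\<gamma> > 0"
  shows "\<forall>\<^sub>F t in at_left (1 / \<gamma>). 0 < t \<and> t < 1 / \<gamma>"
  unfolding eventually_at_left_field using assms by (intro exI[of _ 0]) auto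

text \<open>The factorisation \<open>one_minus_z\<close> makes q^(2/\<gamma>) equal to (1 -
  z)^(2/\<gamma>) times \<open>w t\<close>, before any limit is taken. The exponent matches
  \<open>gauss_series_tendsto_powr\<close> with c = 2, since (1 + a) + (1 + b) = 2 +
  2/\<gamma>.\<close>

lemma uR_limit:
  assumes "\<theta> > 0" "\<gamma> > 0" "x > 0"
  shows "((\<lambda>t. complex_of_real (uR \<theta> \<gamma> t x)) \<longlongrightarrow>
    of_real (\<gamma> * Gamma (2 / \<gamma>)) / (Gamma (sigma1 \<theta> / of_real \<gamma>) * Gamma (sigma2 \<theta> / of_real \<gamma>)) *
      of_real ((1 + x powr \<gamma>) powr (- (2 / \<gamma>)))) (at_left (1 / \<gamma>))"
proof -
  define a b where "a = sigma1 \<theta> / of_real \<gamma>" and "b = sigma2 \<theta> / of_real \<gamma>"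
  define z where "z t = \<gamma> * t * (1 + (\<gamma> * t - 1) * x powr \<gamma>)" for t
  define w where "w t = (1 + \<gamma> * t * x powr \<gamma>) powr (- (2 / \<gamma>))" for t
  have one_minus_z: "1 - z t = (1 - \<gamma> * t) * (1 + \<gamma> * t * x powr \<gamma>)" for t
    by (simp add: z_def algebra_simps)
  have ab: "a + b = of_real (2 / \<gamma>)" "a * b = of_real (\<theta> / \<gamma>\<^sup>2)"
    by (simp_all add: a_def b_def sigma_prod power2_eq_square flip: add_divide_distrib sigma_sum[of \<theta>])
  have pos: "1 + \<gamma> * t * x powr \<gamma> > 0" "1 - \<gamma> * t > 0" if "0 < t" "t < 1 / \<gamma>" for t
    using that assms by (auto intro!: add_pos_nonneg simp: field_simps)
  have z_lim: "filterlim z (at_left 1) (at_left (1 / \<gamma>))"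
    unfolding filterlim_at
  proof
    show "\<forall>\<^sub>F t in at_left (1 / \<gamma>). z t \<in> {..<1} \<and> z t \<noteq> 1"
      using eventually_at_left_inverse[OF assms(2)]
    proof eventually_elim
      case (elim t)
      have "1 - z t > 0" unfolding one_minus_z using pos[of t] elim by simp
      then show ?case by simp
    qed
    show "(z \<longlongrightarrow> 1) (at_left (1 / \<gamma>))"
      unfolding z_def using assms by (auto intro!: tendsto_eq_intros)
  qed
  have "((\<lambda>y. of_real ((1 - y) powr (2 / \<gamma>)) * hyp2F1 (1 + a) (1 + b) 2 (of_real y)) \<longlongrightarrow>
      rGamma (1 + a) * rGamma (1 + b) / (rGamma 2 * rGamma (of_real (2 / \<gamma>)))) (at_left 1)"
    unfolding hyp2F1_eq_gauss_series
    by (rule gauss_series_tendsto_powr) (use assms ab(1) in \<open>auto simp: algebra_simps intro: Re_pos_not_nonpos_Int\<close>)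
  note lim = filterlim_compose[OF this z_lim]
  have w_lim: "(w \<longlongrightarrow> (1 + x powr \<gamma>) powr (- (2 / \<gamma>))) (at_left (1 / \<gamma>))"
    unfolding w_def using assms pos[of 0]
    by (auto intro!: tendsto_eq_intros simp: add_nonneg_eq_0_iff)
  have "((\<lambda>t. of_real (\<theta> * t * w t) * (of_real ((1 - z t) powr (2 / \<gamma>)) * hyp2F1 (1 + a) (1 + b) 2 (of_real (z t)))) \<longlongrightarrow>
      of_real (\<theta> * (1 / \<gamma>) * (1 + x powr \<gamma>) powr (- (2 / \<gamma>))) *
        (rGamma (1 + a) * rGamma (1 + b) / (rGamma 2 * rGamma (of_real (2 / \<gamma>))))) (at_left (1 / \<gamma>))"
    by (intro tendsto_mult tendsto_of_real w_lim lim tendsto_const tendsto_ident_at)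
  moreover have "\<forall>\<^sub>F t in at_left (1 / \<gamma>).
      of_real (\<theta> * t * w t) * (of_real ((1 - z t) powr (2 / \<gamma>)) * hyp2F1 (1 + a) (1 + b) 2 (of_real (z t))) =
      complex_of_real (uR \<theta> \<gamma> t x)"
  proof -
    have "\<forall>\<^sub>F y in at_left 1. 0 < y \<and> y < (1::real)"
      using eventually_at_left_inverse[of 1] by simp
    then have "\<forall>\<^sub>F t in at_left (1 / \<gamma>). 0 < z t \<and> z t < 1"
      using z_lim by (rule eventually_compose_filterlim)
    with eventually_at_left_inverse[OF assms(2)] show ?thesis
    proof eventually_elim
      case (elim t)
      have "(1 - z t) powr (2 / \<gamma>) = (1 - \<gamma> * t) powr (2 / \<gamma>) * (1 + \<gamma> * t * x powr \<gamma>) powr (2 / \<gamma>)"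
        unfolding one_minus_z by (rule powr_mult)
      then have "w t * (1 - z t) powr (2 / \<gamma>) = (1 - \<gamma> * t) powr (2 / \<gamma>)"
        using pos[of t] elim by (simp add: w_def powr_minus)
      then have "complex_of_real (\<theta> * (1 - \<gamma> * t) powr (2 / \<gamma>) * t) =
          of_real (\<theta> * t * w t) * of_real ((1 - z t) powr (2 / \<gamma>))"
        by (metis mult.assoc mult.commute of_real_mult)
      moreover have "complex_of_real (Re (hyp2F1 (1 + a) (1 + b) 2 (of_real (z t)))) = hyp2F1 (1 + a) (1 + b) 2 (of_real (z t))"
        unfolding a_def b_def using elim by (intro hyp2F1_real_nonneg(1)[OF assms(1,2), symmetric]) auto
      ultimately show ?case
        unfolding uR_def z_def[symmetric] a_def[symmetric] b_def[symmetric] of_real_mult[of "\<theta> * (1 - \<gamma> * t) powr (2 / \<gamma>) * t"]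
        by (simp only: mult.assoc)
    qed
  qed
  ultimately have "((\<lambda>t. complex_of_real (uR \<theta> \<gamma> t x)) \<longlongrightarrow>
      of_real (\<theta> * (1 / \<gamma>) * (1 + x powr \<gamma>) powr (- (2 / \<gamma>))) *
        (rGamma (1 + a) * rGamma (1 + b) / (rGamma 2 * rGamma (of_real (2 / \<gamma>))))) (at_left (1 / \<gamma>))"
    by (rule Lim_transform_eventually)
  also have "of_real (\<theta> * (1 / \<gamma>) * (1 + x powr \<gamma>) powr (- (2 / \<gamma>))) *
        (rGamma (1 + a) * rGamma (1 + b) / (rGamma 2 * rGamma (of_real (2 / \<gamma>)))) =
      of_real \<gamma> * (of_real (\<theta> / \<gamma>\<^sup>2) * (rGamma (a + 1) * rGamma (b + 1))) / rGamma (of_real (2 / \<gamma>)) *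
        of_real ((1 + x powr \<gamma>) powr (- (2 / \<gamma>)))"
  proof -
    have "rGamma (2 :: complex) = 1" using rGamma_plus1[of "1 :: complex"] by simp
    then show ?thesis using assms by (simp add: power2_eq_square add.commute)
  qed
  \<comment> \<open>As \<theta>/\<gamma>^2 = a b, the recurrence z rGamma (z + 1) = rGamma z absorbs
    it and lowers both arguments by one.\<close>
  also have "of_real (\<theta> / \<gamma>\<^sup>2) * (rGamma (a + 1) * rGamma (b + 1)) = rGamma a * rGamma b"
    unfolding ab(2)[symmetric] rGamma_plus1[of a, symmetric] rGamma_plus1[of b, symmetric]
    by (simp only: mult_ac)
  finally show ?thesis
    unfolding a_def b_def rGamma_inverse_Gamma Gamma_complex_of_real
    by (simp only: divide_inverse inverse_mult_distrib inverse_inverse_eq of_real_mult mult_ac)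
qed

text \<open>Limits are taken in the complex numbers because the Gamma factors have complex
  arguments. The convention 1/\<Gamma> = 0 at poles is respected: \<open>Gamma\<close> is 0 there
  and division by 0 gives 0, so dividing by \<open>Gamma\<close> is multiplying by
  \<open>rGamma\<close>.\<close>

theorem corollary1p2:
  fixes \<theta> \<gamma> :: real
  assumes "\<theta> > 0" and "\<gamma> > 0"
  shows "(\<forall>x>0. ((\<lambda>t. complex_of_real (density_at (u \<theta> \<gamma> t) x)) \<longlongrightarrow>
        of_real (\<gamma> * Gamma (2 / \<gamma>)) / (Gamma (sigma1 \<theta> / of_real \<gamma>) * Gamma (sigma2 \<theta> / of_real \<gamma>)) *
          of_real ((1 + x powr \<gamma>) powr (- (2 / \<gamma>)))) (at_left (1 / \<gamma>))) \<and>
    (\<forall>r>1. ((\<lambda>t. complex_of_real ((1 - \<gamma> * t) powr ((r - 1) / \<gamma>) * (\<integral>x. x powr r \<partial>u \<theta> \<gamma> t))) \<longlongrightarrow>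
        of_real (Gamma ((r + 1) / \<gamma>) * Gamma ((r - 1) / \<gamma>)) /
          (Gamma ((of_real (r + 1) - sigma1 \<theta>) / of_real \<gamma>) *
           Gamma ((of_real (r + 1) - sigma2 \<theta>) / of_real \<gamma>))) (at_left (1 / \<gamma>))) \<and>
    (((\<lambda>t. complex_of_real (- 1 / ln (1 - \<gamma> * t) * (\<integral>x. x \<partial>u \<theta> \<gamma> t))) \<longlongrightarrow>
        of_real (Gamma (2 / \<gamma>)) / (Gamma (sigma1 \<theta> / of_real \<gamma>) * Gamma (sigma2 \<theta> / of_real \<gamma>)))
        (at_left (1 / \<gamma>))) \<and>
    (\<forall>r. 0 < r \<and> r < 1 \<longrightarrow> ((\<lambda>t. complex_of_real (\<integral>x. x powr r \<partial>u \<theta> \<gamma> t)) \<longlongrightarrow>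
        of_real (Gamma ((r + 1) / \<gamma>) * Gamma ((1 - r) / \<gamma>)) /
          (Gamma (sigma1 \<theta> / of_real \<gamma>) * Gamma (sigma2 \<theta> / of_real \<gamma>))) (at_left (1 / \<gamma>)))"
proof (intro conjI allI impI)
  define a b where "a = sigma1 \<theta> / of_real \<gamma>" and "b = sigma2 \<theta> / of_real \<gamma>"
  have ab: "a + b = of_real (2 / \<gamma>)"
    by (simp add: a_def b_def flip: add_divide_distrib sigma_sum[of \<theta>])
  note s_lim = filterlim_mult_at_left_1[OF assms(2)] and t = eventually_at_left_inverse[OF assms(2)]
  note moment = complex_moment_u[OF assms, folded a_def b_def]
  {
    fix x :: real assume x: "x > 0"
    have "\<forall>\<^sub>F t in at_left (1 / \<gamma>). complex_of_real (uR \<theta> \<gamma> t x) = of_real (density_at (u \<theta> \<gamma> t) x)"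
      using eventually_density_at_u[OF assms x] by eventually_elim simp
    with uR_limit[OF assms x] show "((\<lambda>t. complex_of_real (density_at (u \<theta> \<gamma> t) x)) \<longlongrightarrow>
        of_real (\<gamma> * Gamma (2 / \<gamma>)) / (Gamma (sigma1 \<theta> / of_real \<gamma>) * Gamma (sigma2 \<theta> / of_real \<gamma>)) *
          of_real ((1 + x powr \<gamma>) powr (- (2 / \<gamma>)))) (at_left (1 / \<gamma>))"
      by (rule Lim_transform_eventually)
  next
    fix r :: real assume r: "r > 1"
    define p where "p = complex_of_real ((r + 1) / \<gamma>)"
    have pa: "p - a = (of_real (r + 1) - sigma1 \<theta>) / of_real \<gamma>" "p - b = (of_real (r + 1) - sigma2 \<theta>) / of_real \<gamma>"
      by (simp_all add: p_def a_def b_def diff_divide_distrib)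
    have diff: "p - a - b = of_real ((r - 1) / \<gamma>)"
      using ab by (simp add: p_def algebra_simps diff_divide_distrib add_divide_distrib)
    have "((\<lambda>t. \<Sum>n. gauss_coeff a b p n * of_real (\<gamma> * t) ^ n) \<longlongrightarrow>
        rGamma (p - a) * rGamma (p - b) / (rGamma p * rGamma (p - a - b))) (at_left (1 / \<gamma>))"
      using r assms diff by (intro filterlim_compose[OF gauss_series_tendsto_gauss_sum s_lim]) (auto simp: p_def)
    moreover have "\<forall>\<^sub>F t in at_left (1 / \<gamma>). (\<Sum>n. gauss_coeff a b p n * of_real (\<gamma> * t) ^ n) =
        complex_of_real ((1 - \<gamma> * t) powr ((r - 1) / \<gamma>) * (\<integral>x. x powr r \<partial>u \<theta> \<gamma> t))"
      using t
    proof eventually_elim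
      case (elim t)
      then have "1 - \<gamma> * t > 0" using assms by (simp add: field_simps)
      \<comment> \<open>The normalisation in the statement is the inverse of the prefactor of the
        moment, so what remains is the bare Gauss series.\<close>
      then have "(1 - \<gamma> * t) powr ((r - 1) / \<gamma>) * (1 - \<gamma> * t) powr ((1 - r) / \<gamma>) = 1"
        by (simp flip: powr_add add_divide_distrib)
      then show ?case
        unfolding of_real_mult using moment[of t r] elim r
        by (simp only: p_def mult.assoc[symmetric] of_real_mult[symmetric]) simp
    qed
    ultimately have "((\<lambda>t. complex_of_real ((1 - \<gamma> * t) powr ((r - 1) / \<gamma>) * (\<integral>x. x powr r \<partial>u \<theta> \<gamma> t))) \<longlongrightarrow>
        rGamma (p - a) * rGamma (p - b) / (rGamma p * rGamma (p - a - b))) (at_left (1 / \<gamma>))"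
      by (rule Lim_transform_eventually)
    then show "((\<lambda>t. complex_of_real ((1 - \<gamma> * t) powr ((r - 1) / \<gamma>) * (\<integral>x. x powr r \<partial>u \<theta> \<gamma> t))) \<longlongrightarrow>
        of_real (Gamma ((r + 1) / \<gamma>) * Gamma ((r - 1) / \<gamma>)) /
          (Gamma ((of_real (r + 1) - sigma1 \<theta>) / of_real \<gamma>) *
           Gamma ((of_real (r + 1) - sigma2 \<theta>) / of_real \<gamma>))) (at_left (1 / \<gamma>))"
      unfolding diff unfolding pa unfolding p_def rGamma_inverse_Gamma Gamma_complex_of_real
      by (simp only: divide_inverse inverse_mult_distrib inverse_inverse_eq of_real_mult mult_ac)
  next
    fix r :: real assume r: "0 < r \<and> r < 1"
    define p where "p = complex_of_real ((r + 1) / \<gamma>)"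
    have p: "p \<notin> \<int>\<^sub>\<le>\<^sub>0" unfolding p_def using r assms by (intro Re_pos_not_nonpos_Int) simp
    have sum: "a + b = p + of_real ((1 - r) / \<gamma>)"
    proof -
      have "2 / \<gamma> = (r + 1) / \<gamma> + (1 - r) / \<gamma>" by (simp flip: add_divide_distrib)
      then show ?thesis by (simp only: ab p_def of_real_add)
    qed
    \<comment> \<open>For r < 1 the prefactor of the moment is itself the power (1 - z)^d, z =
      \<gamma> t, that tames the series.\<close>
    have "((\<lambda>t. of_real ((1 - \<gamma> * t) powr ((1 - r) / \<gamma>)) * (\<Sum>n. gauss_coeff a b p n * of_real (\<gamma> * t) ^ n)) \<longlongrightarrow>
        rGamma a * rGamma b / (rGamma p * rGamma (of_real ((1 - r) / \<gamma>)))) (at_left (1 / \<gamma>))"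
      using r assms by (intro filterlim_compose[OF gauss_series_tendsto_powr[OF _ sum p] s_lim]) simp
    moreover have "\<forall>\<^sub>F t in at_left (1 / \<gamma>). of_real ((1 - \<gamma> * t) powr ((1 - r) / \<gamma>)) *
        (\<Sum>n. gauss_coeff a b p n * of_real (\<gamma> * t) ^ n) = complex_of_real (\<integral>x. x powr r \<partial>u \<theta> \<gamma> t)"
      using t by eventually_elim (use r moment in \<open>simp add: p_def\<close>)
    ultimately have "((\<lambda>t. complex_of_real (\<integral>x. x powr r \<partial>u \<theta> \<gamma> t)) \<longlongrightarrow>
        rGamma a * rGamma b / (rGamma p * rGamma (of_real ((1 - r) / \<gamma>)))) (at_left (1 / \<gamma>))"
      by (rule Lim_transform_eventually)
    then show "((\<lambda>t. complex_of_real (\<integral>x. x powr r \<partial>u \<theta> \<gamma> t)) \<longlongrightarrow>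
        of_real (Gamma ((r + 1) / \<gamma>) * Gamma ((1 - r) / \<gamma>)) /
          (Gamma (sigma1 \<theta> / of_real \<gamma>) * Gamma (sigma2 \<theta> / of_real \<gamma>))) (at_left (1 / \<gamma>))"
      unfolding a_def b_def p_def rGamma_inverse_Gamma Gamma_complex_of_real
      by (simp only: divide_inverse inverse_mult_distrib inverse_inverse_eq of_real_mult mult_ac)
  }
  have p: "complex_of_real (2 / \<gamma>) \<notin> \<int>\<^sub>\<le>\<^sub>0" using assms by (intro Re_pos_not_nonpos_Int) simp
  have "((\<lambda>t. (\<Sum>n. gauss_coeff a b (of_real (2 / \<gamma>)) n * of_real (\<gamma> * t) ^ n) / of_real (- ln (1 - \<gamma> * t))) \<longlongrightarrow>
      rGamma a * rGamma b / rGamma (of_real (2 / \<gamma>))) (at_left (1 / \<gamma>))"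
    by (intro filterlim_compose[OF gauss_series_tendsto_ln[OF p ab] s_lim])
  moreover have "\<forall>\<^sub>F t in at_left (1 / \<gamma>).
      (\<Sum>n. gauss_coeff a b (of_real (2 / \<gamma>)) n * of_real (\<gamma> * t) ^ n) / of_real (- ln (1 - \<gamma> * t)) =
      complex_of_real (- 1 / ln (1 - \<gamma> * t) * (\<integral>x. x \<partial>u \<theta> \<gamma> t))"
    using t
  proof eventually_elim
    case (elim t)
    then have "1 - \<gamma> * t > 0" using assms by (simp add: field_simps)
    then have "(\<Sum>n. gauss_coeff a b (of_real (2 / \<gamma>)) n * of_real (\<gamma> * t) ^ n) = of_real (\<integral>x. x powr 1 \<partial>u \<theta> \<gamma> t)"
      using moment[of t 1] elim by simp
    \<comment> \<open>The integrands agree because the measure lives on the positive reals.\<close>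
    also have "(\<integral>x. x powr 1 \<partial>u \<theta> \<gamma> t) = (\<integral>x. x \<partial>u \<theta> \<gamma> t)"
      by (intro Bochner_Integration.integral_cong) (auto simp: space_u)
    finally show ?case by simp
  qed
  ultimately have "((\<lambda>t. complex_of_real (- 1 / ln (1 - \<gamma> * t) * (\<integral>x. x \<partial>u \<theta> \<gamma> t))) \<longlongrightarrow>
      rGamma a * rGamma b / rGamma (of_real (2 / \<gamma>))) (at_left (1 / \<gamma>))"
    by (rule Lim_transform_eventually)
  then show "((\<lambda>t. complex_of_real (- 1 / ln (1 - \<gamma> * t) * (\<integral>x. x \<partial>u \<theta> \<gamma> t))) \<longlongrightarrow>
        of_real (Gamma (2 / \<gamma>)) / (Gamma (sigma1 \<theta> / of_real \<gamma>) * Gamma (sigma2 \<theta> / of_real \<gamma>)))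
        (at_left (1 / \<gamma>))"
    unfolding a_def b_def rGamma_inverse_Gamma Gamma_complex_of_real
    by (simp only: divide_inverse inverse_mult_distrib inverse_inverse_eq of_real_mult mult_ac)
qed

end
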